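(* Let $n\ge 3$ be an integer, $d>2(n-1)$ a real number, and $\varepsilon>0$. For any approximation function $\psi$, any $s>\frac{n-1}{2}$ and any $\mathscr{M}\in\mathscr{G}(\mathscr{H}_d^{\mathbf 0}(\mathbb{R}^{n-1}))$ we have $\mathcal{H}^s(\mathscr{S}_n(\psi)\cap\mathscr{M})=0$ if $$\sum_{q\ge 1}\Big(\frac{\psi(q)}{q}\Big)^{s+1}q^n<\infty\quad\text{and}\quad\sum_{q\ge 1}\Big(\frac{\psi(q)}{q}\Big)^{s+\frac{n-1}{d}+\varepsilon}q^{n-1}<\infty.$$
   Context: An approximation function is a non-increasing function $\psi:\mathbb{Z}_{\ge 1}\to(0,1/2)$. $\mathscr{S}_n(\psi)$ is the set of simultaneously $\psi$-approximable vectors: all $\mathbf{x}=(x_1,\dots,x_n)\in\mathbb{R}^n$ such that $\max_{1\le i\le n}\lVert q x_i\rVert<\psi(q)$ for infinitely many integers $q\ge 1$, where $\lVert x\rVert=\min_{z\in\mathbb{Z}}|x-z|$. $\mathcal{H}^s$ is the Hausdorff $s$-measure on $\mathbb{R}^n$. $\mathscr{H}_d^{\mathbf 0}(\mathbb{R}^{n-1})$ is the set of functions $f:\mathbb{R}^{n-1}\to\mathbb{R}$ with $f(\lambda\mathbf{x})=\lambda^d f(\mathbf{x})$ for all $\mathbf{x}$ and all $\lambda\ge 0$, that are smooth on $\mathbb{R}^{n-1}\setminus\{\mathbf 0\}$ and have Hessian determinant $\det H_f(\mathbf{x})\ne 0$ for all $\mathbf{x}\ne\mathbf 0$. $\mathscr{G}(\mathscr{H}_d^{\mathbf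 0}(\mathbb{R}^{n-1}))$ is the set of hypersurfaces $\mathscr{M}\subset\mathbb{R}^n$ of the form $\mathscr{M}=\{(\mathbf{x},f(\mathbf{x})):\mathbf{x}\in\mathbb{R}^{n-1},\ \lVert\mathbf{x}\rVert_2<1\}$ with $f\in\mathscr{H}_d^{\mathbf 0}(\mathbb{R}^{n-1})$. *)

theory Defs
  imports "HOL-Analysis.Analysis"
begin

definition approximation_function :: "(nat \<Rightarrow> real) \<Rightarrow> bool" where
  "approximation_function \<psi> \<longleftrightarrow>
     (\<forall>q\<ge>1. 0 < \<psi> q \<and> \<psi> q < 1 / 2) \<and>
     (\<forall>q r. 1 \<le> q \<and> q \<le> r \<longrightarrow> \<psi> r \<le> \<psi> q)"

definition dist_int :: "real \<Rightarrow> real" where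
  "dist_int x = infdist x \<int>"

text \<open>The inner products with the elements of \<^term>\<open>Basis\<close> are the standard coordinates. For
  \<^typ>\<open>(real ^ 'm) \<times> real\<close> they are the components of the first factor together with the second
  factor.\<close>

definition simult_approximable :: "(nat \<Rightarrow> real) \<Rightarrow> 'a::euclidean_space set" where
  "simult_approximable \<psi> =
     {x. infinite {q::nat. q \<ge> 1 \<and> Max ((\<lambda>b. dist_int (real q * (x \<bullet> b))) ` Basis) < \<psi> q}}"

text \<open>Hausdorff \<open>s\<close>-measure for \<open>s \<ge> 0\<close>, without a normalising constant. Finite covers are
  included because members of a cover may be empty. The gauge makes the usual convention
  \<open>0\<^sup>0 = 1\<close> for nonempty sets explicit, since \<open>0 powr 0 = 0\<close> in the library. Boundedness of the
  covering sets is required because \<^const>\<open>diameter\<close> is unspecified on unbounded sets.\<close>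

definition hausdorff_gauge :: "real \<Rightarrow> 'a::metric_space set \<Rightarrow> ennreal" where
  "hausdorff_gauge s U =
     (if U = {} then 0 else if s = 0 then 1 else ennreal (diameter U powr s))"

definition hausdorff_premeasure :: "real \<Rightarrow> real \<Rightarrow> 'a::metric_space set \<Rightarrow> ennreal" where
  "hausdorff_premeasure s \<delta> A =
     (INF U \<in> {U :: nat \<Rightarrow> 'a set. A \<subseteq> (\<Union>i. U i) \<and> (\<forall>i. bounded (U i) \<and> diameter (U i) \<le> \<delta>)}.
        \<Sum>i. hausdorff_gauge s (U i))"

definition hausdorff_measure :: "real \<Rightarrow> 'a::metric_space set \<Rightarrow> ennreal" where
  "hausdorff_measure s A = (SUP \<delta> \<in> {0<..}. hausdorff_premeasure s \<delta> A)"

text \<open>\<open>C\<^sup>k\<close> and \<open>C\<^sup>\<infinity>\<close> regularity; intended for open \<open>S\<close>.\<close>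

fun Ck_on :: "nat \<Rightarrow> 'a::euclidean_space set \<Rightarrow> ('a \<Rightarrow> 'b::real_normed_vector) \<Rightarrow> bool" where
  "Ck_on 0 S f \<longleftrightarrow> continuous_on S f"
| "Ck_on (Suc k) S f \<longleftrightarrow>
     (\<forall>x\<in>S. f differentiable (at x)) \<and>
     (\<forall>v. Ck_on k S (\<lambda>x. frechet_derivative f (at x) v))"

definition smooth_on :: "'a::euclidean_space set \<Rightarrow> ('a \<Rightarrow> 'b::real_normed_vector) \<Rightarrow> bool" where
  "smooth_on S f \<longleftrightarrow> (\<forall>k. Ck_on k S f)"

definition partial_deriv :: "'m::finite \<Rightarrow> (real ^ 'm \<Rightarrow> real) \<Rightarrow> real ^ 'm \<Rightarrow> real" where
  "partial_deriv i f x = frechet_derivative f (at x) (axis i 1)"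

definition hessian :: "(real ^ 'm \<Rightarrow> real) \<Rightarrow> real ^ 'm \<Rightarrow> real ^ 'm ^ ('m::finite)" where
  "hessian f x = (\<chi> i j. partial_deriv i (partial_deriv j f) x)"

definition homogeneous_nondeg :: "real \<Rightarrow> (real ^ 'm::finite \<Rightarrow> real) set" where
  "homogeneous_nondeg d =
     {f. (\<forall>x. \<forall>c\<ge>0. f (c *\<^sub>R x) = c powr d * f x) \<and>
         smooth_on (UNIV - {0}) f \<and>
         (\<forall>x. x \<noteq> 0 \<longrightarrow> det (hessian f x) \<noteq> 0)}"

text \<open>\<open>\<real>\<^sup>n\<close> is represented as \<open>\<real>\<^sup>n\<^sup>-\<^sup>1 \<times> \<real>\<close>, whose library norm is the Euclidean one.\<close>

definition graph_hypersurfaces ::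
    "(real ^ 'm::finite \<Rightarrow> real) set \<Rightarrow> ((real ^ 'm) \<times> real) set set" where
  "graph_hypersurfaces F = {M. \<exists>f\<in>F. M = {(x, f x) | x. norm x < 1}}"

end

theory Submission
  imports Defs
begin

text \<open>Since \<open>\<H>\<^sup>s\<close>-null sets are closed under countable unions, it suffices to consider the part of the
  hypersurface over a small ball \<open>D\<close> away from the origin, where \<open>\<nabla>f\<close> is bi-Lipschitz. A rational
  point \<open>(a, b) / q\<close> with \<open>q \<le> Q\<close> that is \<open>\<delta> / q\<close>-close to the graph corresponds to an integer vector in
  one of the boxes
  \<open>\<bar>q\<bar> \<le> Q\<close>, \<open>\<bar>a - q t\<bar> \<le> \<surd>(\<delta> Q)\<close>, \<open>\<bar>b - q f t - \<nabla>f t \<bullet> (a - q t)\<bar> \<le> \<delta>\<close> with \<open>t \<in> D\<close>.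
  The number of integer points of a box is at most a constant times its volume times the number of
  integer points of the polar box, and the polar box has the same shape for the Legendre transform
  of \<open>f\<close>, with \<open>(Q, \<delta>)\<close> replaced by \<open>(1 / \<delta>, 1 / Q)\<close>. Averaging over \<open>t\<close> bounds the count for \<open>f\<close> by
  the count for its dual, and a bound \<open>Q powr (n - 1 + e)\<close> for one of them at \<open>\<delta> = 2 / Q\<close> improves to
  \<open>Q powr (n - 1 + e / (1 + e))\<close> for the other. Iterating this from a trivial bound shows that there
  are \<open>O(\<delta> Q ^ n)\<close> points whenever \<open>\<delta> \<ge> Q powr (- \<theta>)\<close>, for every \<open>\<theta> < 1\<close>. With this count, covering
  by balls around the rational points with dyadic \<open>q\<close> proves the theorem, because \<open>s > (n - 1) / 2\<close>
  leaves room for \<open>\<theta>\<close> to be slightly less than \<open>1\<close>.\<close>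

section \<open>Integer points and polar bodies\<close>

definition int_points :: "'a::euclidean_space set" where
  "int_points = {z. \<forall>b\<in>Basis. z \<bullet> b \<in> \<int>}"

lemma int_points_prod: "(x, y) \<in> int_points \<longleftrightarrow> x \<in> int_points \<and> y \<in> int_points"
  by (simp add: int_points_def Basis_prod_def ball_Un)

lemma int_points_real: "(x::real) \<in> int_points \<longleftrightarrow> x \<in> \<int>"
  by (simp add: int_points_def)

lemma int_points_diff: "z \<in> int_points \<Longrightarrow> w \<in> int_points \<Longrightarrow> z - w \<in> int_points"
  by (auto simp: int_points_def inner_diff_left)

lemma int_points_inner: "z \<in> int_points \<Longrightarrow> w \<in> int_points \<Longrightarrow> z \<bullet> w \<in> \<int>"
  by (subst euclidean_inner) (auto simp: int_points_def)

lemma finite_int_points_bounded: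
  fixes A :: "'a::euclidean_space set"
  assumes "bounded A"
  shows "finite (A \<inter> int_points)"
proof -
  obtain B where B: "\<And>x. x \<in> A \<Longrightarrow> norm x \<le> B"
    using assms by (auto simp: bounded_iff)
  define F where "F = {k \<in> \<int>. \<bar>k::real\<bar> \<le> B}"
  have "finite F" unfolding F_def by (rule finite_abs_int_segment)
  then have fin: "finite (Pi\<^sub>E (Basis::'a set) (\<lambda>_. F))" by (intro finite_PiE) auto
  have "A \<inter> int_points \<subseteq> (\<lambda>f. \<Sum>b\<in>Basis. f b *\<^sub>R b) ` (Pi\<^sub>E (Basis::'a set) (\<lambda>_. F))"
  proof
    fix x assume x: "x \<in> A \<inter> int_points"
    define f where "f = (\<lambda>b\<in>Basis. x \<bullet> b)"
    have "f \<in> Pi\<^sub>E (Basis::'a set) (\<lambda>_. F)"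
    proof (rule PiE_I)
      fix b :: 'a assume b: "b \<in> Basis"
      have "\<bar>x \<bullet> b\<bar> \<le> B" using Basis_le_norm[OF b, of x] B[of x] x by auto
      then show "f b \<in> F" using x b by (auto simp: f_def F_def int_points_def)
    qed (auto simp: f_def)
    moreover have "x = (\<Sum>b\<in>Basis. f b *\<^sub>R b)"
      by (simp add: f_def euclidean_representation cong: sum.cong)
    ultimately show "x \<in> (\<lambda>f. \<Sum>b\<in>Basis. f b *\<^sub>R b) ` (Pi\<^sub>E (Basis::'a set) (\<lambda>_. F))" by blast
  qed
  then show ?thesis using fin finite_surj by blast
qed

section \<open>Characters of the torus: orthogonality and mean squares\<close>

lemma cis_two_pi_Ints: "x \<in> \<int> \<Longrightarrow> cis (2 * pi * x) = 1"
  by (auto elim!: Ints_cases intro!: cis_multiple_2pi)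

lemma integral_unit_interval_cis:
  assumes "k \<in> \<int>"
  shows "(LINT x|lborel. indicator {0..1::real} x *\<^sub>R cis (2 * pi * (k * x))) = (if k = 0 then 1 else 0)"
proof (cases "k = 0")
  case False
  have d: "((\<lambda>x. cis (2 * pi * (k * x)) / (\<i> * of_real (2 * pi * k))) has_vector_derivative cis (2 * pi * (k * x))) (at x within {0..1})" for x
  proof -
    have "((\<lambda>x. cis (2 * pi * (k * x))) has_vector_derivative (2 * pi * k) *\<^sub>R (\<i> * cis (2 * pi * (k * x)))) (at x within {0..1})"
    proof -
      have "((\<lambda>w. exp (\<i> * (2 * of_real pi * of_real k) * w)) has_field_derivative
          (\<i> * (2 * of_real pi * of_real k)) * exp (\<i> * (2 * of_real pi * of_real k) * of_real x)) (at (of_real x))"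
        by (auto intro!: derivative_eq_intros)
      from has_vector_derivative_real_field[OF this] show ?thesis
        by (simp add: cis_conv_exp scaleR_conv_of_real mult_ac)
    qed
    then have "((\<lambda>x. cis (2 * pi * (k * x)) / (\<i> * of_real (2 * pi * k))) has_vector_derivative ((2 * pi * k) *\<^sub>R (\<i> * cis (2 * pi * (k * x)))) / (\<i> * of_real (2 * pi * k))) (at x within {0..1})"
      by (rule has_vector_derivative_divide)
    then show ?thesis using False by (simp add: scaleR_conv_of_real)
  qed
  have "(LINT x|lborel. indicator {0..1::real} x *\<^sub>R cis (2 * pi * (k * x))) =
     cis (2 * pi * (k * 1)) / (\<i> * of_real (2 * pi * k)) - cis (2 * pi * (k * 0)) / (\<i> * of_real (2 * pi * k))"
    by (rule integral_FTC_Icc[OF _ d]) (auto intro!: continuous_intros)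
  also have "\<dots> = 0" using cis_two_pi_Ints[OF assms] by simp
  finally show ?thesis using False by simp
qed (simp add: scaleR_conv_of_real)

text \<open>The integrand is a product of functions of single coordinates, so the integral is the
  product of the one-dimensional ones, and one nonzero coordinate of \<open>z\<close> makes it
  vanish.\<close>

lemma integral_unit_cube_cis:
  fixes z :: "'a::euclidean_space"
  assumes z: "z \<in> int_points"
  shows "(LINT \<theta>|lborel. indicator (cbox 0 One) \<theta> *\<^sub>R cis (2 * pi * (z \<bullet> \<theta>))) = (if z = 0 then 1 else 0)"
proof -
  interpret product_sigma_finite "\<lambda>b::'a. lborel :: real measure" ..
  define g where "g = (\<lambda>(b::'a) x. indicator {0..1::real} x *\<^sub>R cis (2 * pi * ((z \<bullet> b) * x)))"
  have split: "indicator (cbox 0 One) \<theta> *\<^sub>R cis (2 * pi * (z \<bullet> \<theta>)) = (\<Prod>b\<in>Basis. g b (\<theta> \<bullet> b))" for \<theta> :: 'a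
  proof -
    have "(\<Prod>b\<in>(Basis::'a set). g b (\<theta> \<bullet> b)) = (\<Prod>b\<in>(Basis::'a set). of_real (indicator {0..1::real} (\<theta> \<bullet> b))) * (\<Prod>b\<in>(Basis::'a set). cis (2 * pi * ((z \<bullet> b) * (\<theta> \<bullet> b))))"
      by (simp add: g_def scaleR_conv_of_real prod.distrib)
    also have "(\<Prod>b\<in>(Basis::'a set). (of_real (indicator {0..1::real} (\<theta> \<bullet> b)) :: complex)) = of_real (indicator (cbox 0 One) \<theta>)"
      by (auto simp: cbox_def indicator_def prod_zero_iff intro!: prod.neutral)
    also have "(\<Prod>b\<in>(Basis::'a set). cis (2 * pi * ((z \<bullet> b) * (\<theta> \<bullet> b)))) = cis (2 * pi * (z \<bullet> \<theta>))"
      by (subst euclidean_inner[of z]) (simp add: cis_conv_exp exp_sum sum_distrib_left sum_distrib_right)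
    finally show ?thesis by (simp add: scaleR_conv_of_real)
  qed
  have int: "integrable lborel (g b)" for b
    unfolding g_def by (rule borel_integrable_compact) (auto intro!: continuous_intros)
  have [measurable]: "g b \<in> borel_measurable borel" for b
    using borel_measurable_integrable[OF int[of b]] by simp
  have "(LINT \<theta>|lborel. indicator (cbox 0 One) \<theta> *\<^sub>R cis (2 * pi * (z \<bullet> \<theta>))) = (LINT \<theta>|lborel. (\<Prod>b\<in>(Basis::'a set). g b (\<theta> \<bullet> b)))"
    by (simp add: split)
  also have "\<dots> = (LINT f|(\<Pi>\<^sub>M b\<in>(Basis::'a set). lborel). (\<Prod>b\<in>(Basis::'a set). g b ((\<Sum>c\<in>Basis. f c *\<^sub>R c) \<bullet> b)))"
    by (subst lborel_eq, subst integral_distr) auto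
  also have "\<dots> = (LINT f|(\<Pi>\<^sub>M b\<in>(Basis::'a set). lborel). (\<Prod>b\<in>(Basis::'a set). g b (f b)))"
    by (intro Bochner_Integration.integral_cong refl prod.cong) (auto simp: inner_sum_left inner_Basis if_distrib cong: if_cong)
  also have "\<dots> = (\<Prod>b\<in>(Basis::'a set). LINT x|lborel. g b x)"
    by (rule product_integral_prod) (auto intro: int)
  also have "\<dots> = (\<Prod>b\<in>(Basis::'a set). if z \<bullet> b = 0 then 1 else 0)"
    using z by (intro prod.cong refl) (auto simp: g_def integral_unit_interval_cis int_points_def)
  also have "\<dots> = (if z = 0 then 1 else 0)"
    by (auto simp: prod_zero_iff euclidean_eq_iff[of z 0] intro!: prod.neutral)
  finally show ?thesis .
qed

text \<open>Parseval: expanding the square gives the characters of all differences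
  \<open>z - w\<close>, and orthogonality leaves only the diagonal.\<close>

lemma integral_unit_cube_exp_sum:
  fixes S :: "'a::euclidean_space set"
  assumes "finite S" "S \<subseteq> int_points"
  shows "(\<integral>\<^sup>+\<theta>. ennreal ((cmod (\<Sum>z\<in>S. cis (2 * pi * (z \<bullet> \<theta>))))\<^sup>2) * indicator (cbox 0 One) \<theta> \<partial>lborel) = ennreal (card S)"
proof -
  define T where "T = (\<lambda>\<theta>. \<Sum>z\<in>S. cis (2 * pi * (z \<bullet> \<theta>)))"
  define e where "e = (\<lambda>z \<theta>::'a. indicator (cbox 0 (One::'a)) \<theta> *\<^sub>R cis (2 * pi * (z \<bullet> \<theta>)))"
  have int: "integrable lborel (e z)" for z
    unfolding e_def by (rule borel_integrable_compact) (auto intro!: continuous_intros)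
  have eq: "complex_of_real ((cmod (T \<theta>))\<^sup>2 * indicator (cbox 0 One) \<theta>) = (\<Sum>z\<in>S. \<Sum>w\<in>S. e (z - w) \<theta>)" for \<theta>
  proof -
    have "complex_of_real ((cmod (T \<theta>))\<^sup>2) = T \<theta> * cnj (T \<theta>)"
      by (rule complex_norm_square)
    also have "\<dots> = (\<Sum>z\<in>S. \<Sum>w\<in>S. cis (2 * pi * ((z - w) \<bullet> \<theta>)))"
      by (simp add: T_def cis_cnj sum_product cis_mult inner_diff_left right_diff_distrib)
    finally show ?thesis by (simp add: e_def scaleR_conv_of_real sum_distrib_left mult.commute)
  qed
  have int2: "integrable lborel (\<lambda>\<theta>. (\<Sum>z\<in>S. \<Sum>w\<in>S. e (z - w) \<theta>))"
    using int by auto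
  have i3: "integrable lborel (\<lambda>\<theta>. (cmod (T \<theta>))\<^sup>2 * indicator (cbox 0 One) \<theta>)"
    using int2 unfolding eq[symmetric] complex_of_real_integrable_eq .
  have "complex_of_real (LINT \<theta>|lborel. (cmod (T \<theta>))\<^sup>2 * indicator (cbox 0 One) \<theta>) = (LINT \<theta>|lborel. (\<Sum>z\<in>S. \<Sum>w\<in>S. e (z - w) \<theta>))"
    by (subst integral_complex_of_real[symmetric]) (simp only: eq)
  also have "\<dots> = (\<Sum>z\<in>S. \<Sum>w\<in>S. integral\<^sup>L lborel (e (z - w)))"
    using int by (simp add: Bochner_Integration.integral_sum Bochner_Integration.integrable_sum)
  also have "\<dots> = (\<Sum>z\<in>S. \<Sum>w\<in>S. if w = z then 1 else 0)"
    using assms unfolding e_def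
    by (intro sum.cong refl) (subst integral_unit_cube_cis, auto intro: int_points_diff)
  also have "\<dots> = of_nat (card S)" using assms by (simp add: sum.delta)
  finally have I: "(LINT \<theta>|lborel. (cmod (T \<theta>))\<^sup>2 * indicator (cbox 0 One) \<theta>) = card S"
    by (metis of_real_eq_iff of_real_of_nat_eq)
  have "(\<integral>\<^sup>+\<theta>. ennreal ((cmod (T \<theta>))\<^sup>2 * indicator (cbox 0 One) \<theta>) \<partial>lborel) = ennreal (card S)"
    using nn_integral_eq_integral[OF i3] I by simp
  then show ?thesis unfolding T_def
    by (simp add: ennreal_mult ennreal_indicator)
qed

text \<open>The exponential sum over \<open>S\<close> has mean square \<open>card S\<close> on the torus, but its modulus is at least
  \<open>card S / 2\<close> on \<open>K\<close>. The differences of elements of \<open>K\<close> bound how often \<open>K\<close> overlaps itself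
  on the torus.\<close>

lemma card_int_points_polar:
  fixes S K :: "'a::euclidean_space set"
  assumes S: "finite S" "S \<subseteq> int_points" and K: "bounded K" "K \<in> sets borel"
    and small: "\<And>z \<theta>. z \<in> S \<Longrightarrow> \<theta> \<in> K \<Longrightarrow> \<bar>z \<bullet> \<theta>\<bar> \<le> 1 / 6"
  shows "card S * measure lborel K \<le> 4 * card (int_points \<inter> {x - y | x y. x \<in> K \<and> y \<in> K})"
proof -
  define N where "N = card (int_points \<inter> {x - y | x y. x \<in> K \<and> y \<in> K})"
  define g where "g = (\<lambda>\<theta>. ennreal ((cmod (\<Sum>z\<in>S. cis (2 * pi * (z \<bullet> \<theta>))))\<^sup>2))"
  have [measurable]: "g \<in> borel_measurable borel" unfolding g_def
    by (intro measurable_compose[OF _ measurable_ennreal] borel_measurable_continuous_onI) (auto intro!: continuous_intros)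
  note K(2)[measurable]
  \<comment> \<open>Rounding down each coordinate cuts \<open>K\<close> into pieces along integer
    translates of the unit cube; \<open>W\<close> below is the finite set of translates that meet
    \<open>K\<close>.\<close>
  define c where "c = (\<lambda>\<theta>::'a. \<Sum>b\<in>Basis. of_int \<lfloor>\<theta> \<bullet> b\<rfloor> *\<^sub>R b)"
  have cb: "c \<theta> \<bullet> b = of_int \<lfloor>\<theta> \<bullet> b\<rfloor>" if "b \<in> Basis" for \<theta> b
    using that by (simp add: c_def)
  have c1: "c \<theta> \<in> int_points" for \<theta>
    by (auto simp: int_points_def cb)
  have c2: "\<theta> - c \<theta> \<in> cbox 0 One" for \<theta>
    by (auto simp: cbox_def inner_diff_left cb) linarith
  define W where "W = int_points \<inter> {x - y | x y. x \<in> K \<and> y \<in> cbox 0 One}"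
  have bd: "bounded {x - y | x y. x \<in> K \<and> y \<in> A}" if "bounded A" for A :: "'a set"
    using bounded_minus[OF K(1) that] by (auto elim: bounded_subset)
  have finW: "finite W" unfolding W_def
    using finite_int_points_bounded[OF bd[OF bounded_cbox, of 0 One]] by (simp add: Int_commute)
  have finN: "finite (int_points \<inter> {x - y | x y. x \<in> K \<and> y \<in> K})"
    using finite_int_points_bounded[OF bd[OF K(1)]] by (simp add: Int_commute)
  have per: "g (\<theta> + v) = g \<theta>" if "v \<in> int_points" for \<theta> v
  proof -
    have "cis (2 * pi * (z \<bullet> (\<theta> + v))) = cis (2 * pi * (z \<bullet> \<theta>))" if z: "z \<in> S" for z
      using int_points_inner[of z v] z S(2) \<open>v \<in> int_points\<close>
      by (simp add: inner_add_right distrib_left cis_mult[symmetric] cis_two_pi_Ints subset_iff)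
    then show ?thesis by (simp add: g_def)
  qed
  have low: "ennreal ((card S / 2)\<^sup>2) \<le> g \<theta>" if "\<theta> \<in> K" for \<theta>
  proof -
    have "1 / 2 \<le> Re (cis (2 * pi * (z \<bullet> \<theta>)))" if "z \<in> S" for z
    proof -
      \<comment> \<open>The bound 1/6 in \<open>small\<close> keeps every angle within pi/3, where
        the cosine is at least 1/2, so the terms of the sum cannot cancel.\<close>
      have "\<bar>2 * pi * (z \<bullet> \<theta>)\<bar> \<le> pi / 3"
        using small[OF that \<open>\<theta> \<in> K\<close>] pi_gt_zero by (simp add: abs_mult field_simps)
      then have "cos (pi / 3) \<le> cos \<bar>2 * pi * (z \<bullet> \<theta>)\<bar>"
        by (intro cos_monotone_0_pi_le) auto
      then show ?thesis by (simp add: cos_60)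
    qed
    then have "(\<Sum>z\<in>S. 1 / 2) \<le> (\<Sum>z\<in>S. Re (cis (2 * pi * (z \<bullet> \<theta>))))"
      by (rule sum_mono)
    then have "card S / 2 \<le> Re (\<Sum>z\<in>S. cis (2 * pi * (z \<bullet> \<theta>)))" by simp
    also have "\<dots> \<le> cmod (\<Sum>z\<in>S. cis (2 * pi * (z \<bullet> \<theta>)))" by (rule complex_Re_le_cmod)
    finally show ?thesis unfolding g_def by (intro ennreal_leI power_mono) auto
  qed
  have "ennreal ((card S / 2)\<^sup>2) * emeasure lborel K = (\<integral>\<^sup>+\<theta>. ennreal ((card S / 2)\<^sup>2) * indicator K \<theta> \<partial>lborel)"
    by (subst nn_integral_cmult_indicator) auto
  also have "\<dots> \<le> (\<integral>\<^sup>+\<theta>. (\<Sum>v\<in>W. g \<theta> * indicator K \<theta> * indicator (cbox 0 One) (\<theta> - v)) \<partial>lborel)"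
  proof (rule nn_integral_mono)
    fix \<theta> :: 'a
    show "ennreal ((card S / 2)\<^sup>2) * indicator K \<theta> \<le> (\<Sum>v\<in>W. g \<theta> * indicator K \<theta> * indicator (cbox 0 One) (\<theta> - v))"
    proof (cases "\<theta> \<in> K")
      case True
      have "c \<theta> = \<theta> - (\<theta> - c \<theta>)" by simp
      then have W: "c \<theta> \<in> W" using c1 c2 True unfolding W_def by blast
      have "ennreal ((card S / 2)\<^sup>2) * indicator K \<theta> \<le> g \<theta> * indicator K \<theta> * indicator (cbox 0 One) (\<theta> - c \<theta>)"
        using low[OF True] True c2[of \<theta>] by simp
      also have "\<dots> \<le> (\<Sum>v\<in>W. g \<theta> * indicator K \<theta> * indicator (cbox 0 One) (\<theta> - v))"
        by (rule member_le_sum[OF W _ finW]) auto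
      finally show ?thesis .
    qed simp
  qed
  also have "\<dots> = (\<Sum>v\<in>W. \<integral>\<^sup>+\<theta>. g \<theta> * indicator K \<theta> * indicator (cbox 0 One) (\<theta> - v) \<partial>lborel)"
    by (rule nn_integral_sum) measurable
  \<comment> \<open>Translation by \<open>v\<close> moves each piece into the unit cube;
    \<open>g\<close> does not change because it is periodic.\<close>
  also have "\<dots> = (\<Sum>v\<in>W. \<integral>\<^sup>+\<theta>. g \<theta> * indicator K (v + \<theta>) * indicator (cbox 0 One) \<theta> \<partial>lborel)"
  proof (intro sum.cong refl)
    fix v assume v: "v \<in> W"
    have "(\<integral>\<^sup>+\<theta>. g \<theta> * indicator K \<theta> * indicator (cbox 0 One) (\<theta> - v) \<partial>lborel) =
      (\<integral>\<^sup>+\<theta>. g \<theta> * indicator K \<theta> * indicator (cbox 0 One) (\<theta> - v) \<partial>distr lborel borel ((+) v))"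
      by (simp only: lborel_distr_plus)
    also have "\<dots> = (\<integral>\<^sup>+\<theta>. g (v + \<theta>) * indicator K (v + \<theta>) * indicator (cbox 0 One) (v + \<theta> - v) \<partial>lborel)"
      by (rule nn_integral_distr) measurable
    finally show "(\<integral>\<^sup>+\<theta>. g \<theta> * indicator K \<theta> * indicator (cbox 0 One) (\<theta> - v) \<partial>lborel) = 
       (\<integral>\<^sup>+\<theta>. g \<theta> * indicator K (v + \<theta>) * indicator (cbox 0 One) \<theta> \<partial>lborel)"
      using per[of v] v by (simp add: W_def add.commute)
  qed
  also have "\<dots> = (\<integral>\<^sup>+\<theta>. (\<Sum>v\<in>W. g \<theta> * indicator K (v + \<theta>) * indicator (cbox 0 One) \<theta>) \<partial>lborel)"
    by (rule nn_integral_sum[symmetric]) measurable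
  also have "\<dots> \<le> (\<integral>\<^sup>+\<theta>. ennreal N * (g \<theta> * indicator (cbox 0 One) \<theta>) \<partial>lborel)"
  proof (rule nn_integral_mono)
    fix \<theta> :: 'a
    have "(\<Sum>v\<in>W. indicator K (v + \<theta>)) = (of_nat (card {v\<in>W. v + \<theta> \<in> K}) :: ennreal)"
      using finW by (simp add: indicator_def sum.If_cases Int_def)
    \<comment> \<open>Subtracting one fixed such translate \<open>u\<close> injects all of them into
      the integral differences of \<open>K\<close>.\<close>
    also have "card {v\<in>W. v + \<theta> \<in> K} \<le> N"
    proof (cases "{v\<in>W. v + \<theta> \<in> K} = {}")
      case False
      then obtain u where u: "u \<in> W" "u + \<theta> \<in> K" by auto
      have "(\<lambda>v. v - u) ` {v\<in>W. v + \<theta> \<in> K} \<subseteq> int_points \<inter> {x - y | x y. x \<in> K \<and> y \<in> K}"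
      proof clarify
        fix v assume v: "v \<in> W" "v + \<theta> \<in> K"
        have "v - u = (v + \<theta>) - (u + \<theta>)" by simp
        then show "v - u \<in> int_points \<inter> {x - y | x y. x \<in> K \<and> y \<in> K}"
          using u v int_points_diff unfolding W_def by blast
      qed
      then have "card ((\<lambda>v. v - u) ` {v\<in>W. v + \<theta> \<in> K}) \<le> N"
        unfolding N_def by (rule card_mono[OF finN])
      then show ?thesis by (subst (asm) card_image) (auto simp: inj_on_def)
    next
      case True
      show ?thesis unfolding True by simp
    qed
    finally have "(\<Sum>v\<in>W. indicator K (v + \<theta>)) \<le> ennreal N"
      by (simp add: ennreal_of_nat_eq_real_of_nat)
    then have "g \<theta> * indicator (cbox 0 One) \<theta> * (\<Sum>v\<in>W. indicator K (v + \<theta>)) \<le> g \<theta> * indicator (cbox 0 One) \<theta> * ennreal N"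
      by (rule mult_left_mono) simp
    then show "(\<Sum>v\<in>W. g \<theta> * indicator K (v + \<theta>) * indicator (cbox 0 One) \<theta>) \<le> ennreal N * (g \<theta> * indicator (cbox 0 One) \<theta>)"
      by (simp add: sum_distrib_left sum_distrib_right mult_ac)
  qed
  also have "\<dots> = ennreal N * (\<integral>\<^sup>+\<theta>. g \<theta> * indicator (cbox 0 One) \<theta> \<partial>lborel)"
    by (rule nn_integral_cmult) simp
  also have "\<dots> = ennreal N * ennreal (card S)"
    unfolding g_def integral_unit_cube_exp_sum[OF S] ..
  finally have main: "ennreal ((card S / 2)\<^sup>2) * emeasure lborel K \<le> ennreal N * ennreal (card S)" .
  have "emeasure lborel K < \<infinity>" using emeasure_bounded_finite[OF K(1)] .
  then have e: "emeasure lborel K = ennreal (measure lborel K)"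
    by (intro emeasure_eq_ennreal_measure) auto
  have "ennreal ((card S / 2)\<^sup>2 * measure lborel K) = ennreal ((card S / 2)\<^sup>2) * ennreal (measure lborel K)"
    by (rule ennreal_mult) auto
  also have "\<dots> \<le> ennreal N * ennreal (card S)" using main unfolding e .
  also have "\<dots> = ennreal (real N * card S)" by (rule ennreal_mult[symmetric]) auto
  finally have r: "(card S / 2)\<^sup>2 * measure lborel K \<le> N * card S"
    by (subst (asm) ennreal_le_iff) auto
  show ?thesis
  proof (cases "card S = 0")
    case False
    then have "card S * (card S * measure lborel K) \<le> card S * (4 * real N)"
      using r by (simp add: power2_eq_square field_simps)
    then show ?thesis using False by (subst (asm) mult_le_cancel_left_pos) (auto simp: N_def)
  qed (simp)
qed

section \<open>Frames\<close>

type_synonym 'a triple = "real \<times> 'a \<times> real"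

text \<open>A triple \<open>(x, y, z)\<close> stands for the rational point \<open>(y / x, z / x)\<close>. The hypersurface \<open>z = f y\<close> is
  encoded by \<open>p t = t\<close>, \<open>s = \<nabla>f\<close> and \<open>r t = f t - \<nabla>f t \<bullet> t\<close>; then \<open>frame_bet\<close> is the tangential and
  \<open>frame_gam\<close> the normal displacement of the triple from the ray through \<open>(1, t, f t)\<close>. Keeping \<open>p\<close>,
  \<open>r\<close>, \<open>s\<close> arbitrary makes the setting symmetric: up to signs, interchanging \<open>p\<close> and \<open>s\<close> yields the
  frame of the Legendre transform of \<open>f\<close>, parametrised by the same \<open>t\<close>.\<close>

definition frame_bet :: "('a \<Rightarrow> 'a) \<Rightarrow> 'a \<Rightarrow> 'a triple \<Rightarrow> 'a::euclidean_space" where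
  "frame_bet p t v = fst (snd v) - fst v *\<^sub>R p t"

definition frame_gam :: "('a \<Rightarrow> real) \<Rightarrow> ('a \<Rightarrow> 'a) \<Rightarrow> 'a \<Rightarrow> 'a::euclidean_space triple \<Rightarrow> real" where
  "frame_gam r s t v = snd (snd v) - fst v * r t - fst (snd v) \<bullet> s t"

definition frame_box :: "('a \<Rightarrow> 'a) \<Rightarrow> ('a \<Rightarrow> real) \<Rightarrow> ('a \<Rightarrow> 'a) \<Rightarrow> 'a \<Rightarrow> real \<Rightarrow> real \<Rightarrow> real \<Rightarrow> 'a::euclidean_space triple set" where
  "frame_box p r s t Q B G = {v. \<bar>fst v\<bar> \<le> Q \<and> norm (frame_bet p t v) \<le> B \<and> \<bar>frame_gam r s t v\<bar> \<le> G}"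

definition frame_points :: "'a set \<Rightarrow> ('a \<Rightarrow> 'a) \<Rightarrow> ('a \<Rightarrow> real) \<Rightarrow> ('a \<Rightarrow> 'a) \<Rightarrow> real \<Rightarrow> real \<Rightarrow> real \<Rightarrow> 'a::euclidean_space triple set" where
  "frame_points D p r s Q B G = int_points \<inter> (\<Union>t\<in>D. frame_box p r s t Q B G)"

text \<open>The two-sided bounds for \<open>s\<close> carry the nondegeneracy of the Hessian. The
  last condition is a second-order Taylor bound: for the graph of \<open>f\<close> its left side is
  the absolute value of \<open>f t - f u - s u \<bullet> (t - u)\<close>.\<close>

definition frame :: "'a set \<Rightarrow> real \<Rightarrow> ('a \<Rightarrow> 'a) \<Rightarrow> ('a \<Rightarrow> real) \<Rightarrow> ('a::euclidean_space \<Rightarrow> 'a) \<Rightarrow> bool" where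
  "frame D L p r s \<longleftrightarrow> 1 \<le> L \<and> continuous_on D r \<and>
     (\<forall>t\<in>D. \<forall>u\<in>D. norm (p t - p u) \<le> L * norm (t - u) \<and> norm (t - u) \<le> L * norm (p t - p u) \<and>
        norm (s t - s u) \<le> L * norm (t - u) \<and> norm (t - u) \<le> L * norm (s t - s u) \<and>
        \<bar>r u - r t + p t \<bullet> (s u - s t)\<bar> \<le> L * (norm (t - u))\<^sup>2)"

lemma frameD:
  assumes "frame D L p r s" "t \<in> D" "u \<in> D"
  shows "norm (p t - p u) \<le> L * norm (t - u)" "norm (t - u) \<le> L * norm (p t - p u)"
    "norm (s t - s u) \<le> L * norm (t - u)" "norm (t - u) \<le> L * norm (s t - s u)"
    "\<bar>r u - r t + p t \<bullet> (s u - s t)\<bar> \<le> L * (norm (t - u))\<^sup>2"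
  using assms unfolding frame_def by blast+

lemma frame_continuous:
  assumes "frame D L p r s"
  shows "continuous_on D p" "continuous_on D s" "continuous_on D r"
proof -
  have L: "0 \<le> L" using assms by (auto simp: frame_def)
  show "continuous_on D p"
    by (rule lipschitz_on_continuous_on[of L])
       (use L frameD(1)[OF assms] in \<open>auto simp: lipschitz_on_def dist_norm\<close>)
  show "continuous_on D s"
    by (rule lipschitz_on_continuous_on[of L])
       (use L frameD(3)[OF assms] in \<open>auto simp: lipschitz_on_def dist_norm\<close>)
  show "continuous_on D r" using assms by (auto simp: frame_def)
qed

text \<open>The remainder of the dual is, up to sign, the original remainder plus
  \<open>(p u - p t) \<bullet> (s u - s t)\<close>, a product of two Lipschitz increments; hence the
  constant \<open>L + L\<^sup>2\<close>.\<close>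

lemma frame_dual:
  assumes f: "frame D L p r s"
  shows "frame D (L + L\<^sup>2) (\<lambda>t. - s t) (\<lambda>t. - r t - p t \<bullet> s t) (\<lambda>t. - p t)"
proof -
  have L: "1 \<le> L" using f by (auto simp: frame_def)
  have LL: "L * x \<le> (L + L\<^sup>2) * x" if "0 \<le> x" for x
    using that L by (intro mult_right_mono) auto
  have "\<bar>(- r u - p u \<bullet> s u) - (- r t - p t \<bullet> s t) + (- s t) \<bullet> (- p u - - p t)\<bar> \<le> (L + L\<^sup>2) * (norm (t - u))\<^sup>2"
    if "t \<in> D" "u \<in> D" for t u
  proof -
    have eq: "(- r u - p u \<bullet> s u) - (- r t - p t \<bullet> s t) + (- s t) \<bullet> (- p u - - p t) =
       - (r u - r t + p t \<bullet> (s u - s t)) - (p u - p t) \<bullet> (s u - s t)"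
      by (simp add: algebra_simps inner_commute)
    have "\<bar>(p u - p t) \<bullet> (s u - s t)\<bar> \<le> norm (p u - p t) * norm (s u - s t)"
      by (rule Cauchy_Schwarz_ineq2)
    also have "\<dots> \<le> (L * norm (t - u)) * (L * norm (t - u))"
      using frameD(1,3)[OF f that(2,1)] L by (intro mult_mono) (auto simp: norm_minus_commute)
    finally show ?thesis using frameD(5)[OF f that] unfolding eq
      by (simp add: algebra_simps power2_eq_square)
  qed
  moreover have "continuous_on D (\<lambda>t. - r t - p t \<bullet> s t)"
    using frame_continuous[OF f] by (intro continuous_intros)
  moreover have "1 \<le> L + L\<^sup>2" using L by (simp add: add_increasing2)
  moreover have "norm (- s t - - s u) \<le> (L + L\<^sup>2) * norm (t - u)"
      "norm (t - u) \<le> (L + L\<^sup>2) * norm (- s t - - s u)"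
      "norm (- p t - - p u) \<le> (L + L\<^sup>2) * norm (t - u)"
      "norm (t - u) \<le> (L + L\<^sup>2) * norm (- p t - - p u)"
    if "t \<in> D" "u \<in> D" for t u
    using frameD(1-4)[OF f that(2,1)] LL[of "norm (t - u)"] LL[of "norm (s u - s t)"] LL[of "norm (p u - p t)"]
    by (auto simp: norm_minus_commute[of u t] simp del: distrib_right)
  ultimately show ?thesis
    unfolding frame_def by blast
qed

text \<open>Hence the polar of a box at \<open>t\<close> is, up to constants, a box at \<open>t\<close> for the dual frame.\<close>

lemma frame_pairing:
  "(snd (snd v), fst (snd v), fst v) \<bullet> k =
     fst v * frame_gam (\<lambda>t. - r t - p t \<bullet> s t) (\<lambda>t. - p t) t k
     + frame_bet p t v \<bullet> frame_bet (\<lambda>t. - s t) t k + frame_gam r s t v * fst k"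
  by (cases v; cases k) (simp add: frame_gam_def frame_bet_def algebra_simps inner_commute)

section \<open>Topology, size and stability of the boxes\<close>

lemma closed_frame_times:
  assumes f: "frame D L p r s" and D: "closed D"
  shows "closed {t\<in>D. v \<in> frame_box p r s t Q B G}"
proof -
  note c = frame_continuous[OF f]
  have 1: "closed (D \<inter> (\<lambda>t. frame_bet p t v) -` cball 0 B)"
    unfolding frame_bet_def
    by (rule continuous_closed_preimage[OF _ D closed_cball]) (intro continuous_intros c)
  have 2: "closed (D \<inter> (\<lambda>t. frame_gam r s t v) -` cball 0 G)"
    unfolding frame_gam_def
    by (rule continuous_closed_preimage[OF _ D closed_cball]) (intro continuous_intros c)
  have "{t\<in>D. v \<in> frame_box p r s t Q B G} = (if \<bar>fst v\<bar> \<le> Q then (D \<inter> (\<lambda>t. frame_bet p t v) -` cball 0 B) \<inter> (D \<inter> (\<lambda>t. frame_gam r s t v) -` cball 0 G) else {})"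
    by (auto simp: frame_box_def)
  then show ?thesis using 1 2 by auto
qed

text \<open>A vector \<open>(x, y, z)\<close> is recovered from its displacements by
  \<open>y = frame_bet + x * p t\<close> and
  \<open>z = frame_gam + x * r t + y \<bullet> s t\<close>, and \<open>p\<close>, \<open>r\<close>,
  \<open>s\<close> are bounded on the compact set \<open>D\<close>, so \<open>K\<close> is uniform
  in \<open>t\<close>.\<close>

lemma frame_box_bounded:
  assumes f: "frame D L p r s" and D: "compact D"
  shows "\<exists>K\<ge>1. \<forall>t\<in>D. \<forall>Q B G v. v \<in> frame_box p r s t Q B G \<longrightarrow> norm v \<le> K * (Q + B + G)"
proof -
  note c = frame_continuous[OF f]
  obtain P where P: "\<And>t. t \<in> D \<Longrightarrow> norm (p t) \<le> P"
    using compact_imp_bounded[OF compact_continuous_image[OF c(1) D]] by (auto simp: bounded_iff)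
  obtain S where S: "\<And>t. t \<in> D \<Longrightarrow> norm (s t) \<le> S"
    using compact_imp_bounded[OF compact_continuous_image[OF c(2) D]] by (auto simp: bounded_iff)
  obtain R where R: "\<And>t. t \<in> D \<Longrightarrow> \<bar>r t\<bar> \<le> R"
    using compact_imp_bounded[OF compact_continuous_image[OF c(3) D]] by (auto simp: bounded_iff)
  define P' where "P' = max P 0"
  define S' where "S' = max S 0"
  define R' where "R' = max R 0"
  define K where "K = 1 + (1 + P') + (1 + R' + (1 + P') * S')"
  have nn: "0 \<le> P'" "0 \<le> S'" "0 \<le> R'" by (auto simp: P'_def S'_def R'_def)
  have "norm v \<le> K * (Q + B + G)" if t: "t \<in> D" and v: "v \<in> frame_box p r s t Q B G" for t Q B G v
  proof -
    obtain x y z where v': "v = (x, y, z)" by (cases v)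
    have h: "\<bar>x\<bar> \<le> Q" "norm (y - x *\<^sub>R p t) \<le> B" "\<bar>z - x * r t - y \<bullet> s t\<bar> \<le> G"
      using v by (auto simp: v' frame_box_def frame_bet_def frame_gam_def)
    have n: "norm (p t) \<le> P'" "norm (s t) \<le> S'" "\<bar>r t\<bar> \<le> R'"
      using P[OF t] S[OF t] R[OF t] by (auto simp: P'_def S'_def R'_def)
    define q where "q = Q + B + G"
    have q: "Q \<le> q" "B \<le> q" "G \<le> q" "0 \<le> q"
      using h norm_ge_zero[of "y - x *\<^sub>R p t"] unfolding q_def by linarith+
    have "norm y \<le> norm (y - x *\<^sub>R p t) + norm (x *\<^sub>R p t)" using norm_triangle_ineq[of "y - x *\<^sub>R p t" "x *\<^sub>R p t"] by simp
    also have "\<dots> \<le> q + q * P'"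
      using h n q nn by (auto intro!: add_mono mult_mono)
    finally have y: "norm y \<le> q * (1 + P')" by (simp add: algebra_simps)
    have "\<bar>x * r t\<bar> \<le> q * R'" using h n q nn unfolding abs_mult by (intro mult_mono) auto
    moreover have "\<bar>y \<bullet> s t\<bar> \<le> q * (1 + P') * S'"
      using Cauchy_Schwarz_ineq2[of y "s t"] mult_mono[OF y n(2)] q nn by auto
    ultimately have z: "\<bar>z\<bar> \<le> q + q * R' + q * (1 + P') * S'" using h(3) q by linarith
    have "norm v \<le> \<bar>x\<bar> + (norm y + \<bar>z\<bar>)"
      unfolding v' using norm_Pair_le[of x "(y, z)"] norm_Pair_le[of y z] by auto
    also have "\<dots> \<le> q + (q * (1 + P') + (q + q * R' + q * (1 + P') * S'))"
      using h y z q by linarith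
    also have "\<dots> = K * q" by (simp add: K_def algebra_simps)
    finally show ?thesis by (simp add: q_def)
  qed
  moreover have "1 \<le> K" using nn by (simp add: K_def)
  ultimately show ?thesis by blast
qed

lemma finite_frame_points:
  assumes "frame D L p r s" "compact D"
  shows "finite (frame_points D p r s Q B G)"
proof -
  obtain K where K: "\<forall>t\<in>D. \<forall>Q B G v. v \<in> frame_box p r s t Q B G \<longrightarrow> norm v \<le> K * (Q + B + G)"
    using frame_box_bounded[OF assms] by blast
  have "bounded (\<Union>t\<in>D. frame_box p r s t Q B G)"
    by (rule boundedI[where B = "K * (Q + B + G)"]) (use K in blast)
  from finite_int_points_bounded[OF this] show ?thesis
    by (simp add: frame_points_def Int_commute)
qed

lemma frame_box_scale:
  assumes "Q \<le> Q'" "B \<le> B'" "G \<le> G'"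
  shows "frame_box p r s t Q B G \<subseteq> frame_box p r s t Q' B' G'"
  using assms by (auto simp: frame_box_def)

lemma frame_box_diff:
  assumes "v \<in> frame_box p r s t Q B G" "w \<in> frame_box p r s t Q B G"
  shows "v - w \<in> frame_box p r s t (2 * Q) (2 * B) (2 * G)"
proof -
  have "frame_bet p t (v - w) = frame_bet p t v - frame_bet p t w"
    by (simp add: frame_bet_def algebra_simps)
  moreover have "frame_gam r s t (v - w) = frame_gam r s t v - frame_gam r s t w"
    by (simp add: frame_gam_def algebra_simps)
  moreover have "norm (frame_bet p t v - frame_bet p t w) \<le> norm (frame_bet p t v) + norm (frame_bet p t w)"
    by (rule norm_triangle_ineq4)
  ultimately show ?thesis using assms by (auto simp: frame_box_def)
qed

text \<open>The move changes \<open>frame_bet\<close> by \<open>fst v\<close> times an increment of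
  \<open>p\<close>, and \<open>frame_gam\<close> by \<open>fst v\<close> times the Taylor remainder
  plus the tangential displacement paired with an increment of \<open>s\<close>. The two conditions
  on the widths absorb these changes; equality in both forces \<open>B = sqrt (G * Q)\<close>, the
  shape used for counting.\<close>

lemma frame_box_move:
  assumes f: "frame D L p r s" and D: "t \<in> D" "u \<in> D" and v: "v \<in> frame_box p r s t Q B G"
    and d: "norm (t - u) \<le> \<sigma>" and Q: "Q * \<sigma> \<le> B" "B * \<sigma> \<le> G"
  shows "v \<in> frame_box p r s u Q ((1 + 2 * L) * B) ((1 + 2 * L) * G)"
proof -
  have L: "1 \<le> L" using f by (auto simp: frame_def)
  have h: "\<bar>fst v\<bar> \<le> Q" "norm (frame_bet p t v) \<le> B" "\<bar>frame_gam r s t v\<bar> \<le> G"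
    using v by (auto simp: frame_box_def)
  have nn: "0 \<le> Q" "0 \<le> B" "0 \<le> \<sigma>" 
    using h norm_ge_zero[of "frame_bet p t v"] norm_ge_zero[of "t - u"] d by linarith+
  have b: "frame_bet p u v = frame_bet p t v - fst v *\<^sub>R (p u - p t)"
    by (simp add: frame_bet_def algebra_simps)
  have g: "frame_gam r s u v = frame_gam r s t v - fst v * (r u - r t + p t \<bullet> (s u - s t)) - frame_bet p t v \<bullet> (s u - s t)"
    by (simp add: frame_bet_def frame_gam_def algebra_simps)
  have dd: "norm (p u - p t) \<le> L * \<sigma>" "norm (s u - s t) \<le> L * \<sigma>" "\<bar>r u - r t + p t \<bullet> (s u - s t)\<bar> \<le> L * \<sigma>\<^sup>2"
    using frameD[OF f D] d L power_mono[OF d, of 2]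
    by (auto simp: norm_minus_commute intro: order_trans mult_left_mono)
  have "norm (fst v *\<^sub>R (p u - p t)) \<le> Q * (L * \<sigma>)"
    using h dd nn by (auto intro!: mult_mono)
  also have "\<dots> = L * (Q * \<sigma>)" by simp
  also have "\<dots> \<le> L * B" using L Q by (intro mult_left_mono) auto
  finally have "norm (frame_bet p u v) \<le> B + L * B"
    unfolding b using h norm_triangle_ineq4[of "frame_bet p t v" "fst v *\<^sub>R (p u - p t)"] by linarith
  moreover have "0 \<le> L * B" "(1 + 2 * L) * B = B + L * B + L * B"
    using L nn by (simp_all add: algebra_simps)
  ultimately have B: "norm (frame_bet p u v) \<le> (1 + 2 * L) * B" by linarith
  have "\<bar>fst v * (r u - r t + p t \<bullet> (s u - s t))\<bar> \<le> Q * (L * \<sigma>\<^sup>2)"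
    unfolding abs_mult using h dd nn by (intro mult_mono) auto
  also have "\<dots> = L * ((Q * \<sigma>) * \<sigma>)" by (simp add: power2_eq_square)
  also have "\<dots> \<le> L * (B * \<sigma>)" using L Q nn by (intro mult_left_mono mult_right_mono) auto
  also have "\<dots> \<le> L * G" using L Q by (intro mult_left_mono) auto
  finally have 1: "\<bar>fst v * (r u - r t + p t \<bullet> (s u - s t))\<bar> \<le> L * G" .
  have "\<bar>frame_bet p t v \<bullet> (s u - s t)\<bar> \<le> B * (L * \<sigma>)"
    using Cauchy_Schwarz_ineq2[of "frame_bet p t v" "s u - s t"] mult_mono[OF h(2) dd(2)] nn by auto
  also have "\<dots> = L * (B * \<sigma>)" by simp
  also have "\<dots> \<le> L * G" using L Q by (intro mult_left_mono) auto
  finally have "\<bar>frame_gam r s u v\<bar> \<le> G + L * G + L * G"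
    unfolding g using 1 h by linarith
  then show ?thesis using B h by (simp add: frame_box_def algebra_simps)
qed

section \<open>Volume of a box\<close>

lemma measurable_frame_box:
  "frame_box p r s t Q B G \<in> sets borel"
proof -
  have "closed (fst -` cball 0 Q \<inter> frame_bet p t -` cball 0 B \<inter> frame_gam r s t -` cball 0 G)"
    unfolding frame_bet_def frame_gam_def
    by (intro closed_Int closed_vimage closed_cball) (intro continuous_intros)+
  also have "fst -` cball 0 Q \<inter> frame_bet p t -` cball 0 B \<inter> frame_gam r s t -` cball 0 G = frame_box p r s t Q B G"
    by (auto simp: frame_box_def)
  finally show ?thesis by (rule borel_closed)
qed

text \<open>Passing from \<open>(x, y, z)\<close> to \<open>x\<close> and the two displacements is a
  shear of determinant 1, so the volume is that of a product. The proof slices first along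
  \<open>x\<close>, then along \<open>y\<close>.\<close>

lemma measure_frame_box:
  fixes t :: "'a::euclidean_space"
  assumes "0 \<le> Q" "0 \<le> B" "0 \<le> G"
  shows "measure lborel (frame_box p r s t Q B G) = 4 * Q * G * measure lborel (cball (0::'a) B)"
proof -
  have inner: "emeasure lborel (Pair y -` (Pair x -` frame_box p r s t Q B G)) = ennreal (2 * G) * indicator (cball (x *\<^sub>R p t) B) y"
    if "\<bar>x\<bar> \<le> Q" for x y
  proof -
    have "Pair y -` (Pair x -` frame_box p r s t Q B G) = (if y \<in> cball (x *\<^sub>R p t) B then {(x * r t + y \<bullet> s t) - G .. (x * r t + y \<bullet> s t) + G} else {})"
      using that by (auto simp: frame_box_def frame_bet_def frame_gam_def dist_norm norm_minus_commute abs_le_iff)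
    then show ?thesis using assms by simp
  qed
  have s0: "frame_box p r s t Q B G \<in> sets (lborel \<Otimes>\<^sub>M lborel)"
    unfolding lborel_prod using measurable_frame_box[of p r s t Q B G] by simp
  have s1: "Pair x -` frame_box p r s t Q B G \<in> sets (lborel \<Otimes>\<^sub>M lborel)" for x
    unfolding lborel_prod
    using measurable_sets[OF _ measurable_frame_box[of p r s t Q B G], of "Pair x" borel] by simp
  have mid: "emeasure lborel (Pair x -` frame_box p r s t Q B G) = ennreal (2 * G * measure lborel (cball (0::'a) B)) * indicator {-Q..Q} x" for x
  proof (cases "\<bar>x\<bar> \<le> Q")
    case True
    have "emeasure lborel (Pair x -` frame_box p r s t Q B G) = (\<integral>\<^sup>+y. emeasure lborel (Pair y -` (Pair x -` frame_box p r s t Q B G)) \<partial>lborel)"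
      using lborel.emeasure_pair_measure_alt[OF s1] by (simp add: lborel_prod)
    also have "\<dots> = (\<integral>\<^sup>+y. ennreal (2 * G) * indicator (cball (x *\<^sub>R p t) B) y \<partial>lborel)"
      by (simp add: inner[OF True])
    also have "\<dots> = ennreal (2 * G) * emeasure lborel (cball (x *\<^sub>R p t) B)"
      by (rule nn_integral_cmult_indicator) simp
    also have "\<dots> = ennreal (2 * G) * ennreal (measure lborel (cball (0::'a) B))"
      using assms by (simp add: emeasure_cball content_cball)
    also have "\<dots> = ennreal (2 * G * measure lborel (cball (0::'a) B))"
      using assms by (simp add: ennreal_mult)
    moreover have "x \<in> {-Q..Q}" using True by auto
    ultimately show ?thesis by simp
  next
    case False
    then have "Pair x -` frame_box p r s t Q B G = {}" "x \<notin> {-Q..Q}" by (auto simp: frame_box_def)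
    then show ?thesis by simp
  qed
  have "emeasure lborel (frame_box p r s t Q B G) = (\<integral>\<^sup>+x. emeasure lborel (Pair x -` frame_box p r s t Q B G) \<partial>lborel)"
    using lborel.emeasure_pair_measure_alt[OF s0] by (simp add: lborel_prod)
  also have "\<dots> = ennreal (2 * G * measure lborel (cball (0::'a) B)) * emeasure lborel {-Q..Q}"
    unfolding mid by (rule nn_integral_cmult_indicator) simp
  also have "emeasure lborel {-Q..Q} = ennreal (2 * Q)"
    using assms by (subst emeasure_lborel_Icc) auto
  also have "ennreal (2 * G * measure lborel (cball (0::'a) B)) * ennreal (2 * Q) =
      ennreal (2 * G * measure lborel (cball (0::'a) B) * (2 * Q))"
    using assms by (intro ennreal_mult[symmetric]) auto
  finally show ?thesis using assms by (simp add: measure_def)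
qed

section \<open>Averaging over the frame\<close>

text \<open>Even for \<open>t\<close> on the boundary, pulling \<open>t\<close> towards the centre
  by a proportion \<open>b\<close> of order \<open>\<sigma>\<close> gives a ball of radius
  \<open>b * \<rho>\<close> inside both balls. The factor \<open>\<kappa>\<close> ensures
  \<open>b \<le> 1\<close> and \<open>2 * (b * \<rho>) \<le> \<sigma>\<close>.\<close>

lemma measure_cball_Int_cball:
  fixes a :: "'a::euclidean_space"
  assumes "0 < \<rho>"
  shows "\<exists>c>0. \<forall>t\<in>cball a \<rho>. \<forall>\<sigma>. 0 < \<sigma> \<and> \<sigma> \<le> 1 \<longrightarrow> c * \<sigma> ^ DIM('a) \<le> measure lborel (cball a \<rho> \<inter> cball t \<sigma>)"
proof -
  define \<kappa> where "\<kappa> = min 1 (1 / (2 * \<rho>))"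
  have \<kappa>: "0 < \<kappa>" "\<kappa> \<le> 1" "2 * \<kappa> * \<rho> \<le> 1" 
    using assms by (auto simp: \<kappa>_def min_def field_simps)
  have "unit_ball_vol (DIM('a)) * (\<kappa> * \<rho>) ^ DIM('a) * \<sigma> ^ DIM('a) \<le> measure lborel (cball a \<rho> \<inter> cball t \<sigma>)"
    if t: "t \<in> cball a \<rho>" and \<sigma>: "0 < \<sigma>" "\<sigma> \<le> 1" for t \<sigma>
  proof -
    define b where "b = \<kappa> * \<sigma>"
    have b: "0 < b" "b \<le> 1" using \<kappa> \<sigma> by (auto simp: b_def mult_le_one)
    define y where "y = t + b *\<^sub>R (a - t)"
    have n: "norm (a - t) \<le> \<rho>" using t by (simp add: dist_norm)
    have "a - y = (1 - b) *\<^sub>R (a - t)" by (simp add: y_def algebra_simps)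
    then have "norm (a - y) = (1 - b) * norm (a - t)" using b by simp
    also have "\<dots> \<le> (1 - b) * \<rho>" using n b by (intro mult_left_mono) auto
    finally have 1: "dist a y \<le> (1 - b) * \<rho>" by (simp add: dist_norm)
    have "norm (y - t) = b * norm (a - t)" using b by (simp add: y_def)
    also have "\<dots> \<le> b * \<rho>" using n b by (intro mult_left_mono) auto
    finally have 2: "dist t y \<le> b * \<rho>" by (simp add: dist_norm norm_minus_commute)
    have 3: "2 * (b * \<rho>) \<le> \<sigma>"
      using mult_right_mono[OF \<kappa>(3), of \<sigma>] \<sigma> by (simp add: b_def algebra_simps)
    have "cball y (b * \<rho>) \<subseteq> cball a \<rho> \<inter> cball t \<sigma>"
    proof
      fix x assume "x \<in> cball y (b * \<rho>)"
      then have "dist y x \<le> b * \<rho>" by simp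
      then have "dist a x \<le> (1 - b) * \<rho> + b * \<rho>" "dist t x \<le> b * \<rho> + b * \<rho>"
        using 1 2 dist_triangle[of a x y] dist_triangle[of t x y] by linarith+
      then show "x \<in> cball a \<rho> \<inter> cball t \<sigma>" using 3 by (simp add: algebra_simps)
    qed
    then have "measure lborel (cball y (b * \<rho>)) \<le> measure lborel (cball a \<rho> \<inter> cball t \<sigma>)"
      by (intro measure_mono_fmeasurable) (auto intro!: fmeasurable_compact compact_Int)
    moreover have "0 \<le> b * \<rho>" using b assms by simp
    ultimately show ?thesis
      unfolding content_cball[OF \<open>0 \<le> b * \<rho>\<close>] by (simp add: b_def power_mult_distrib mult_ac)
  qed
  moreover have "unit_ball_vol (DIM('a)) * (\<kappa> * \<rho>) ^ DIM('a) > 0" using \<kappa> assms by simp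
  ultimately show ?thesis by blast
qed

text \<open>Every counted vector lies in the slightly enlarged boxes at all \<open>t\<close> in a ball of radius
  \<open>sqrt (\<delta> / Q)\<close>, so the count is controlled by the integral over \<open>t\<close> of the number of integer points
  in the box at \<open>t\<close>, and \<open>card_int_points_polar\<close> applies to each of these boxes.\<close>

lemma card_frame_points_le:
  fixes a :: "'a::euclidean_space" and p s :: "'a \<Rightarrow> 'a"
  assumes f: "frame (cball a \<rho>) L p r s" and \<rho>: "0 < \<rho>"
  defines "p' \<equiv> (\<lambda>t. - s t)" and "r' \<equiv> (\<lambda>t. - r t - p t \<bullet> s t)" and "s' \<equiv> (\<lambda>t. - p t)"
  shows "\<exists>K>0. \<forall>Q \<delta>. 1 \<le> Q \<and> 0 < \<delta> \<and> \<delta> \<le> Q \<longrightarrow>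
    card (frame_points (cball a \<rho>) p r s Q (sqrt (\<delta> * Q)) \<delta>) \<le>
      K * \<delta> * Q ^ (DIM('a) + 1) *
       (1 + (\<Sum>k\<in>frame_points (cball a \<rho>) p' r' s' (1 / \<delta>) (1 / sqrt (\<delta> * Q)) (1 / Q) - {0}.
          measure lborel {t \<in> cball a \<rho>. k \<in> frame_box p' r' s' t (1 / \<delta>) (1 / sqrt (\<delta> * Q)) (1 / Q)}))"
proof -
  define D where "D = cball a \<rho>"
  have comp: "compact D" and clo: "closed D" by (auto simp: D_def)
  have f1: "frame D L p r s" using f by (simp add: D_def)
  have L: "1 \<le> L" using f by (auto simp: frame_def)
  define L2 where "L2 = L + L\<^sup>2"
  have f2: "frame D L2 p' r' s'"
    unfolding p'_def r'_def s'_def L2_def by (rule frame_dual[OF f1])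
  obtain c3 where c3: "0 < c3" "\<And>t \<sigma>. t \<in> D \<Longrightarrow> 0 < \<sigma> \<Longrightarrow> \<sigma> \<le> 1 \<Longrightarrow> c3 * \<sigma> ^ DIM('a) \<le> measure lborel (D \<inter> cball t \<sigma>)"
    using measure_cball_Int_cball[OF \<rho>, of a] unfolding D_def by blast
  define m where "m = DIM('a)"
  define K1 where "K1 = 1 + 2 * L"
  have K1: "3 \<le> K1" using L by (simp add: K1_def)
  \<comment> \<open>The three terms of the pairing will each be at most \<open>K1 * c\<close>, so
    their sum stays below the 1/6 of the polar bound. Moreover \<open>c \<le> 1 / 2\<close> lets
    differences fit into the full dual box.\<close>
  define c where "c = 1 / (18 * K1)"
  have c: "0 < c" "c \<le> 1 / 2" "c \<le> 1 / 18" "3 * K1 * c \<le> 1 / 6" using K1 by (auto simp: c_def field_simps)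
  define c4 where "c4 = 4 * c * c * unit_ball_vol m * c ^ m"
  have c4: "0 < c4" using c by (simp add: c4_def)
  define K5 where "K5 = 4 / c4"
  have K5: "0 < K5" using c4 by (simp add: K5_def)
  define \<mu>D where "\<mu>D = measure lborel D"
  have \<mu>D: "0 \<le> \<mu>D" by (simp add: \<mu>D_def)
  define K where "K = K5 / c3 * (1 + \<mu>D)"
  have "0 < K" using K5 c3 \<mu>D by (simp add: K_def add_pos_nonneg)
  moreover have "card (frame_points D p r s Q (sqrt (\<delta> * Q)) \<delta>) \<le>
      K * \<delta> * Q ^ (m + 1) *
       (1 + (\<Sum>k\<in>frame_points D p' r' s' (1 / \<delta>) (1 / sqrt (\<delta> * Q)) (1 / Q) - {0}.
          measure lborel {t \<in> D. k \<in> frame_box p' r' s' t (1 / \<delta>) (1 / sqrt (\<delta> * Q)) (1 / Q)}))"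
    if Q: "1 \<le> Q" and \<delta>: "0 < \<delta>" "\<delta> \<le> Q" for Q \<delta>
  proof -
    define B where "B = sqrt (\<delta> * Q)"
    \<comment> \<open>This radius meets both conditions of \<open>frame_box_move\<close> with
      equality: \<open>Q * \<sigma> = B\<close> and \<open>B * \<sigma> = \<delta>\<close>.\<close>
    define \<sigma> where "\<sigma> = sqrt (\<delta> / Q)"
    have B: "0 < B" and \<sigma>: "0 < \<sigma>" "\<sigma> \<le> 1" using Q \<delta> by (auto simp: B_def \<sigma>_def)
    have Q\<sigma>: "Q * \<sigma> = B" 
    proof -
      have "Q * \<sigma> = sqrt (Q\<^sup>2 * (\<delta> / Q))" unfolding \<sigma>_def real_sqrt_mult using Q by simp
      also have "Q\<^sup>2 * (\<delta> / Q) = \<delta> * Q" using Q by (simp add: power2_eq_square)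
      finally show ?thesis by (simp add: B_def)
    qed
    have "B * \<sigma> = sqrt (\<delta>\<^sup>2)" unfolding B_def \<sigma>_def real_sqrt_mult[symmetric] using Q by (simp add: power2_eq_square)
    then have B\<sigma>: "B * \<sigma> = \<delta>" using \<delta> by simp
    define P where "P = frame_points D p r s Q B \<delta>"
    define P' where "P' = frame_points D p' r' s' (1 / \<delta>) (1 / B) (1 / Q)"
    have finP: "finite P" "finite P'" unfolding P_def P'_def
      using finite_frame_points[OF f1 comp] finite_frame_points[OF f2 comp] by auto
    define A where "A = (\<lambda>v. {t \<in> D. v \<in> frame_box p r s t Q (K1 * B) (K1 * \<delta>)})"
    define A' where "A' = (\<lambda>k. {t \<in> D. k \<in> frame_box p' r' s' t (1 / \<delta>) (1 / B) (1 / Q)})"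
    have cA: "compact (A v)" for v
      using compact_Int_closed[OF comp closed_frame_times[OF f1 clo, of v Q "K1 * B" "K1 * \<delta>"]]
      by (simp add: A_def Int_def conj_ac cong: conj_cong)
    have cA': "compact (A' v)" for v
      using compact_Int_closed[OF comp closed_frame_times[OF f2 clo, of v "1 / \<delta>" "1 / B" "1 / Q"]]
      by (simp add: A'_def Int_def conj_ac cong: conj_cong)
    have low: "c3 * \<sigma> ^ m \<le> measure lborel (A v)" if v: "v \<in> P" for v
    proof -
      obtain t where t: "t \<in> D" "v \<in> frame_box p r s t Q B \<delta>"
        using v by (auto simp: P_def frame_points_def)
      have "D \<inter> cball t \<sigma> \<subseteq> A v"
      proof
        fix u assume u: "u \<in> D \<inter> cball t \<sigma>"
        then have "v \<in> frame_box p r s u Q ((1 + 2 * L) * B) ((1 + 2 * L) * \<delta>)"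
          using Q\<sigma> B\<sigma> by (intro frame_box_move[OF f1 t(1) _ t(2)]) (auto simp: dist_norm)
        then show "u \<in> A v" using u by (simp add: A_def K1_def)
      qed
      then have "measure lborel (D \<inter> cball t \<sigma>) \<le> measure lborel (A v)"
        using cA[of v] compact_Int[OF comp compact_cball[of t \<sigma>]]
        by (intro measure_mono_fmeasurable) (auto intro: fmeasurable_compact borel_compact)
      then show ?thesis using c3(2)[OF t(1) \<sigma>] by (simp add: m_def)
    qed
    \<comment> \<open>The inequality to be integrated over \<open>t\<close>: points of the enlarged
      box at \<open>t\<close> against points of the dual box at \<open>t\<close>, the zero vector
      contributing the indicator of \<open>D\<close>.\<close>
    have key: "(\<Sum>v\<in>P. indicator (A v) t) \<le> K5 * \<delta> * Q * B ^ m * (indicator D t + (\<Sum>k\<in>P' - {0}. indicator (A' k) t))" for t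
    proof (cases "t \<in> D")
      case t: True
      define S where "S = {v\<in>P. v \<in> frame_box p r s t Q (K1 * B) (K1 * \<delta>)}"
      \<comment> \<open>\<open>frame_pairing\<close> matches the first coordinate of one vector with
        the last of the other, hence the swap.\<close>
      define sw where "sw = (\<lambda>v::'a triple. (snd (snd v), fst (snd v), fst v))"
      have inj: "inj sw" by (auto simp: inj_def sw_def prod_eq_iff)
      have finS: "finite S" using finP by (simp add: S_def)
      define Kt where "Kt = frame_box p' r' s' t (c / \<delta>) (c / B) (c / Q)"
      have swint: "sw v \<in> int_points" if "v \<in> int_points" for v
        using that by (cases v) (simp add: sw_def int_points_prod int_points_real)
      obtain K0 where K0: "\<forall>t\<in>D. \<forall>Q B G v. v \<in> frame_box p' r' s' t Q B G \<longrightarrow> norm v \<le> K0 * (Q + B + G)"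
        using frame_box_bounded[OF f2 comp] by blast
      have bK: "bounded Kt"
        by (rule boundedI[where B = "K0 * (c / \<delta> + c / B + c / Q)"]) (use K0 t in \<open>auto simp: Kt_def\<close>)
      have card1: "card (sw ` S) * measure lborel Kt \<le> 4 * card (int_points \<inter> {x - y | x y. x \<in> Kt \<and> y \<in> Kt})"
      proof (rule card_int_points_polar[OF _ _ bK])
        show "finite (sw ` S)" using finS by simp
        show "sw ` S \<subseteq> int_points" using swint by (auto simp: S_def P_def frame_points_def)
        show "Kt \<in> sets borel" unfolding Kt_def by (rule measurable_frame_box)
        fix z k assume "z \<in> sw ` S" and k: "k \<in> Kt"
        then obtain v where v: "v \<in> S" "z = sw v" by auto
        have hv: "\<bar>fst v\<bar> \<le> Q" "norm (frame_bet p t v) \<le> K1 * B" "\<bar>frame_gam r s t v\<bar> \<le> K1 * \<delta>"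
          using v by (auto simp: S_def frame_box_def)
        have hk: "\<bar>fst k\<bar> \<le> c / \<delta>" "norm (frame_bet p' t k) \<le> c / B" "\<bar>frame_gam r' s' t k\<bar> \<le> c / Q"
          using k by (auto simp: Kt_def frame_box_def)
        have "\<bar>z \<bullet> k\<bar> = \<bar>fst v * frame_gam r' s' t k + frame_bet p t v \<bullet> frame_bet p' t k + frame_gam r s t v * fst k\<bar>"
          unfolding v(2) sw_def p'_def r'_def s'_def by (subst frame_pairing) (rule refl)
        also have "\<dots> \<le> \<bar>fst v\<bar> * \<bar>frame_gam r' s' t k\<bar> + norm (frame_bet p t v) * norm (frame_bet p' t k) + \<bar>frame_gam r s t v\<bar> * \<bar>fst k\<bar>"
          using Cauchy_Schwarz_ineq2[of "frame_bet p t v" "frame_bet p' t k"]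
          unfolding abs_mult[symmetric] by linarith
        also have "\<dots> \<le> Q * (c / Q) + (K1 * B) * (c / B) + (K1 * \<delta>) * (c / \<delta>)"
          using hv hk Q \<delta> B K1 c by (intro add_mono mult_mono) auto
        also have "\<dots> = c + K1 * c + K1 * c" using Q \<delta> B by simp
        also have "\<dots> \<le> 3 * K1 * c" using K1 mult_right_mono[of 1 K1 c] c by (simp add: algebra_simps)
        also have "\<dots> \<le> 1 / 6" by (rule c)
        finally show "\<bar>z \<bullet> k\<bar> \<le> 1 / 6" .
      qed
      have card2: "card (sw ` S) = card S" by (rule card_image) (use inj in \<open>auto intro: inj_on_subset\<close>)
      have vol: "measure lborel Kt = c4 / (\<delta> * Q * B ^ m)"
        unfolding Kt_def using c Q \<delta> B
        by (subst measure_frame_box) (auto simp: content_cball c4_def m_def power_divide)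
      have cle: "card (int_points \<inter> {x - y | x y. x \<in> Kt \<and> y \<in> Kt}) \<le> 1 + card {k\<in>P' - {0}. t \<in> A' k}"
      proof -
        \<comment> \<open>Taking differences doubles the sides, and \<open>2 * c \<le> 1\<close>.
          The zero vector is set apart and becomes the summand 1.\<close>
        have "int_points \<inter> {x - y | x y. x \<in> Kt \<and> y \<in> Kt} \<subseteq> insert 0 {k\<in>P' - {0}. t \<in> A' k}"
        proof
          fix z assume z: "z \<in> int_points \<inter> {x - y | x y. x \<in> Kt \<and> y \<in> Kt}"
          then obtain x y where h: "x \<in> Kt" "y \<in> Kt" "z = x - y" by blast
          have zi: "z \<in> int_points" using z by blast
          have "x - y \<in> frame_box p' r' s' t (2 * (c / \<delta>)) (2 * (c / B)) (2 * (c / Q))"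
            using h unfolding Kt_def by (intro frame_box_diff) auto
          moreover have "2 * (c / \<delta>) \<le> 1 / \<delta>" "2 * (c / B) \<le> 1 / B" "2 * (c / Q) \<le> 1 / Q"
            using c Q \<delta> B by (auto simp: divide_simps)
          ultimately have "z \<in> frame_box p' r' s' t (1 / \<delta>) (1 / B) (1 / Q)"
            unfolding h(3) by (rule subsetD[OF frame_box_scale, rotated 3])
          then have "z \<in> P'" "t \<in> A' z"
            using zi t unfolding P'_def frame_points_def A'_def by blast+
          then show "z \<in> insert 0 {k\<in>P' - {0}. t \<in> A' k}" by blast
        qed
        then have "card (int_points \<inter> {x - y | x y. x \<in> Kt \<and> y \<in> Kt}) \<le> card (insert 0 {k\<in>P' - {0}. t \<in> A' k})"
          using finP by (intro card_mono) auto
        also have "\<dots> \<le> 1 + card {k\<in>P' - {0}. t \<in> A' k}" using finP by (simp add: card_insert_if)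
        finally show ?thesis .
      qed
      have "card S * (c4 / (\<delta> * Q * B ^ m)) \<le> 4 * real (card (int_points \<inter> {x - y | x y. x \<in> Kt \<and> y \<in> Kt}))"
        using card1 unfolding card2 vol by simp
      also have "\<dots> \<le> 4 * (1 + real (card {k\<in>P' - {0}. t \<in> A' k}))"
        using of_nat_mono[OF cle, where 'a = real] by simp
      finally have "card S * (c4 / (\<delta> * Q * B ^ m)) \<le> 4 * (1 + real (card {k\<in>P' - {0}. t \<in> A' k}))" .
      then have "card S \<le> K5 * \<delta> * Q * B ^ m * (1 + real (card {k\<in>P' - {0}. t \<in> A' k}))"
        using c4 Q \<delta> B by (simp add: K5_def field_simps)
      moreover have "(\<Sum>v\<in>P. indicator (A v) t) = (card S :: real)"
        using finP t by (simp add: indicator_def sum.If_cases A_def S_def Int_def)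
      moreover have "(\<Sum>k\<in>P' - {0}. indicator (A' k) t) = (card {k\<in>P' - {0}. t \<in> A' k} :: real)"
        using finP by (simp add: indicator_def sum.If_cases Int_def)
      ultimately show ?thesis using t by simp
    next
      case False
      then have "indicator (A v) t = (0::real)" "indicator (A' v) t = (0::real)" for v
        by (auto simp: A_def A'_def)
      then show ?thesis using False by simp
    qed
    have iA: "integrable lborel (indicator (A v) :: 'a \<Rightarrow> real)" for v
      using cA[of v] by (intro integrable_real_indicator) (auto intro: borel_compact emeasure_bounded_finite[OF compact_imp_bounded, unfolded infinity_ennreal_def])
    have iA': "integrable lborel (indicator (A' v) :: 'a \<Rightarrow> real)" for v
      using cA'[of v] by (intro integrable_real_indicator) (auto intro: borel_compact emeasure_bounded_finite[OF compact_imp_bounded, unfolded infinity_ennreal_def])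
    have iD: "integrable lborel (indicator D :: 'a \<Rightarrow> real)"
      using comp by (intro integrable_real_indicator) (auto intro: borel_compact emeasure_bounded_finite[OF compact_imp_bounded, unfolded infinity_ennreal_def])
    have "card P * (c3 * \<sigma> ^ m) \<le> (\<Sum>v\<in>P. measure lborel (A v))"
      using sum_mono[OF low, of P] by simp
    also have "\<dots> = (LINT t|lborel. (\<Sum>v\<in>P. indicator (A v) t))"
      using iA by simp
    also have "\<dots> \<le> (LINT t|lborel. K5 * \<delta> * Q * B ^ m * (indicator D t + (\<Sum>k\<in>P' - {0}. indicator (A' k) t)))"
      using iA iA' iD key by (intro integral_mono) auto
    also have "\<dots> = K5 * \<delta> * Q * B ^ m * (\<mu>D + (\<Sum>k\<in>P' - {0}. measure lborel (A' k)))"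
      using iA' iD by (simp add: \<mu>D_def)
    finally have "card P * (c3 * \<sigma> ^ m) \<le> K5 * \<delta> * Q * B ^ m * (\<mu>D + (\<Sum>k\<in>P' - {0}. measure lborel (A' k)))" .
    \<comment> \<open>Since \<open>B = Q * \<sigma>\<close>, a factor \<open>\<sigma> ^ m\<close>
      splits off and cancels against the lower bound for the measure of \<open>A v\<close>.\<close>
    also have "\<dots> = (K5 * \<delta> * Q ^ (m + 1) * (\<mu>D + (\<Sum>k\<in>P' - {0}. measure lborel (A' k)))) * \<sigma> ^ m"
      by (simp add: Q\<sigma>[symmetric] power_mult_distrib)
    finally have "(card P * c3) * \<sigma> ^ m \<le> (K5 * \<delta> * Q ^ (m + 1) * (\<mu>D + (\<Sum>k\<in>P' - {0}. measure lborel (A' k)))) * \<sigma> ^ m"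
      by (simp add: mult_ac)
    then have "card P * c3 \<le> K5 * \<delta> * Q ^ (m + 1) * (\<mu>D + (\<Sum>k\<in>P' - {0}. measure lborel (A' k)))"
      using \<sigma> by (subst (asm) mult_le_cancel_right_pos) auto
    then have "card P \<le> K5 / c3 * (\<delta> * Q ^ (m + 1)) * (\<mu>D + (\<Sum>k\<in>P' - {0}. measure lborel (A' k)))"
      using c3(1) by (simp add: field_simps)
    also have "\<dots> \<le> K5 / c3 * (\<delta> * Q ^ (m + 1)) * ((1 + \<mu>D) * (1 + (\<Sum>k\<in>P' - {0}. measure lborel (A' k))))"
    proof -
      have "0 \<le> (\<Sum>k\<in>P' - {0}. measure lborel (A' k))" by (intro sum_nonneg) auto
      then have "\<mu>D + (\<Sum>k\<in>P' - {0}. measure lborel (A' k)) \<le> (1 + \<mu>D) * (1 + (\<Sum>k\<in>P' - {0}. measure lborel (A' k)))"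
        using \<mu>D by (simp add: algebra_simps)
      then show ?thesis using K5 c3 Q \<delta> by (intro mult_left_mono) auto
    qed
    finally show ?thesis unfolding K_def P_def P'_def A'_def B_def by (simp add: mult_ac)
  qed
  ultimately show ?thesis unfolding D_def m_def by blast
qed

section \<open>Duality and iteration\<close>

lemma int_points_norm_less_1:
  assumes "z \<in> int_points" "norm z < 1"
  shows "z = 0"
proof (rule euclidean_eqI)
  fix b assume b: "b \<in> (Basis :: 'a set)"
  then have "\<bar>z \<bullet> b\<bar> < 1" using Basis_le_norm[OF b, of z] assms by linarith
  moreover have "z \<bullet> b \<in> \<int>" using assms b by (simp add: int_points_def)
  ultimately show "z \<bullet> b = 0 \<bullet> b" using Ints_nonzero_abs_less1 by auto
qed

lemma card_int_points_ball:
  fixes R :: real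
  assumes "0 \<le> R"
  shows "card (int_points \<inter> {z::'a::euclidean_space. norm z \<le> R}) \<le> (2 * R + 1) ^ DIM('a)"
proof -
  define F where "F = {k \<in> \<int>. \<bar>k::real\<bar> \<le> R}"
  have F: "F = of_int ` {-\<lfloor>R\<rfloor>..\<lfloor>R\<rfloor>}"
  proof
    show "F \<subseteq> of_int ` {-\<lfloor>R\<rfloor>..\<lfloor>R\<rfloor>}"
    proof
      fix k assume "k \<in> F"
      then obtain z where "k = of_int z" "of_int z \<le> R" "of_int (- z) \<le> R"
        by (auto simp: F_def abs_le_iff elim!: Ints_cases)
      then show "k \<in> of_int ` {-\<lfloor>R\<rfloor>..\<lfloor>R\<rfloor>}"
        unfolding le_floor_iff[symmetric] by auto
    qed
    show "of_int ` {-\<lfloor>R\<rfloor>..\<lfloor>R\<rfloor>} \<subseteq> F"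
    proof
      fix k :: real assume "k \<in> of_int ` {-\<lfloor>R\<rfloor>..\<lfloor>R\<rfloor>}"
      then obtain z where "k = of_int z" "z \<le> \<lfloor>R\<rfloor>" "- z \<le> \<lfloor>R\<rfloor>" by auto
      then show "k \<in> F" unfolding le_floor_iff by (auto simp: F_def abs_le_iff)
    qed
  qed
  have cF: "card F = 2 * \<lfloor>R\<rfloor> + 1" unfolding F using assms
    by (subst card_image) (auto simp: inj_on_def)
  have finF: "finite F" unfolding F by simp
  have "inj_on (\<lambda>z. \<lambda>b\<in>Basis. z \<bullet> b) (int_points \<inter> {z::'a. norm z \<le> R})"
  proof (rule inj_onI, rule euclidean_eqI)
    fix x y b :: 'a
    assume "(\<lambda>b\<in>Basis. x \<bullet> b) = (\<lambda>b\<in>Basis. y \<bullet> b)" and b: "b \<in> Basis"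
    from fun_cong[OF this(1), of b] b show "x \<bullet> b = y \<bullet> b" by simp
  qed
  moreover have "(\<lambda>z. \<lambda>b\<in>Basis. z \<bullet> b) ` (int_points \<inter> {z::'a. norm z \<le> R}) \<subseteq> Pi\<^sub>E Basis (\<lambda>_. F)"
  proof clarify
    fix z :: 'a assume z: "z \<in> int_points" "norm z \<le> R"
    have "z \<bullet> b \<in> F" if "b \<in> Basis" for b
      using z that Basis_le_norm[OF that, of z] by (auto simp: F_def int_points_def)
    then show "(\<lambda>b\<in>Basis. z \<bullet> b) \<in> Pi\<^sub>E Basis (\<lambda>_. F)" by (simp add: restrict_PiE_iff)
  qed
  ultimately have "card (int_points \<inter> {z::'a. norm z \<le> R}) \<le> card (Pi\<^sub>E (Basis::'a set) (\<lambda>_. F))"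
    by (rule card_inj_on_le) (auto intro!: finite_PiE finF)
  also have "\<dots> = card F ^ DIM('a)" by (simp add: card_PiE)
  finally have "real (card (int_points \<inter> {z::'a. norm z \<le> R})) \<le> real (card F) ^ DIM('a)"
    by (metis of_nat_le_iff of_nat_power)
  also have "\<dots> \<le> (2 * R + 1) ^ DIM('a)"
  proof (rule power_mono)
    have "real (card F) = of_int (2 * \<lfloor>R\<rfloor> + 1)" using cF by (metis of_int_of_nat_eq)
    then show "real (card F) \<le> 2 * R + 1" by simp
  qed auto
  finally show ?thesis .
qed

text \<open>If \<open>k\<close> lies in the boxes at \<open>t\<close> and at \<open>u\<close>, then
  \<open>\<bar>fst k\<bar> * norm (p t - p u) \<le> 2 * B\<close>. The lower Lipschitz bound for
  \<open>p\<close> then puts all such times into one ball of radius of order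
  \<open>B / \<bar>fst k\<bar>\<close>.\<close>

lemma measure_frame_times_le:
  fixes k :: "'a::euclidean_space triple"
  assumes f: "frame D L p r s" and D: "compact D" and k: "fst k \<noteq> 0" and B: "0 \<le> B"
  shows "measure lborel {t\<in>D. k \<in> frame_box p r s t Q B G} \<le> unit_ball_vol (DIM('a)) * (2 * L) ^ DIM('a) * B ^ DIM('a) * inverse \<bar>fst k\<bar> ^ DIM('a)"
proof -
  have L: "1 \<le> L" using f by (auto simp: frame_def)
  let ?A = "{t\<in>D. k \<in> frame_box p r s t Q B G}"
  show ?thesis
  proof (cases "?A = {}")
    case True
    then show ?thesis using L B by (simp only: measure_empty) (intro mult_nonneg_nonneg zero_le_power, auto)
  next
    case False
    then obtain t where t: "t \<in> ?A" by auto
    define R where "R = 2 * L * B * inverse \<bar>fst k\<bar>"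
    have R: "0 \<le> R" using L B by (simp add: R_def)
    have "?A \<subseteq> cball t R"
    proof
      fix u assume u: "u \<in> ?A"
      have "norm (frame_bet p u k - frame_bet p t k) \<le> B + B"
        using t u norm_triangle_ineq4[of "frame_bet p u k" "frame_bet p t k"] by (auto simp: frame_box_def)
      also have "frame_bet p u k - frame_bet p t k = fst k *\<^sub>R (p t - p u)"
        by (simp add: frame_bet_def algebra_simps)
      finally have "\<bar>fst k\<bar> * norm (p t - p u) \<le> 2 * B" by simp
      then have "norm (p t - p u) \<le> 2 * B * inverse \<bar>fst k\<bar>" using k by (simp add: field_simps)
      then have "L * norm (p t - p u) \<le> R" using L mult_left_mono[of _ _ L] by (fastforce simp: R_def mult_ac)
      moreover have "norm (t - u) \<le> L * norm (p t - p u)"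
        using t u by (intro frameD(2)[OF f]) auto
      ultimately show "u \<in> cball t R" by (simp add: dist_norm)
    qed
    moreover have "closed ?A" by (rule closed_frame_times[OF f compact_imp_closed[OF D]])
    ultimately have "measure lborel ?A \<le> measure lborel (cball t R)"
      by (intro measure_mono_fmeasurable) (auto intro: fmeasurable_compact borel_closed)
    also have "\<dots> = unit_ball_vol (DIM('a)) * R ^ DIM('a)" by (rule content_cball[OF R])
    finally show ?thesis by (simp add: R_def power_mult_distrib mult_ac)
  qed
qed

text \<open>With tangential width \<open>1\<close> and normal width \<open>2 / Q\<close> the expected number of points is of order
  \<open>Q ^ DIM('a)\<close>; \<open>e\<close> measures the excess. Since \<open>e\<close> becomes \<open>e / (1 + e)\<close> on passing to the dual
  frame, iteration makes it arbitrarily small.\<close>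

definition frame_growth :: "'a set \<Rightarrow> ('a \<Rightarrow> 'a) \<Rightarrow> ('a \<Rightarrow> real) \<Rightarrow> ('a::euclidean_space \<Rightarrow> 'a) \<Rightarrow> real \<Rightarrow> bool" where
  "frame_growth D p r s e \<longleftrightarrow>
     (\<exists>K>0. \<forall>Q\<ge>1. real (card (frame_points D p r s Q 1 (2 / Q))) \<le> K * Q powr (real DIM('a) + e))"

text \<open>With first coordinate 0 the box conditions bound \<open>y\<close>, and then
  \<open>z\<close>, by numbers below 1, so integrality makes both vanish. Hence
  \<open>measure_frame_times_le\<close> applies to every nonzero dual vector.\<close>

lemma frame_points_fst_nonzero:
  assumes k: "k \<in> frame_points D p r s J B G - {0}" and "B < 1" "G < 1"
  shows "fst k \<noteq> 0"
proof
  assume 0: "fst k = 0"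
  obtain x y z where k': "k = (x, y, z)" by (cases k)
  from k 0 have "norm y \<le> B" "y \<in> int_points" 
    by (auto simp: k' frame_points_def frame_box_def frame_bet_def int_points_prod int_points_real)
  then have y: "y = 0" using assms int_points_norm_less_1[of y] by auto
  from k 0 y have "\<bar>z\<bar> \<le> G" "z \<in> \<int>" by (auto simp: k' frame_points_def frame_box_def frame_gam_def int_points_prod int_points_real)
  then have "z = 0" using assms Ints_nonzero_abs_less1[of z] by auto
  then show False using k 0 y by (simp add: k' zero_prod_def)
qed

text \<open>The vectors \<open>k\<close> are grouped according to the dyadic size of \<open>fst k\<close>.\<close>

lemma sum_measure_frame_times_le:
  fixes p s :: "'a::euclidean_space \<Rightarrow> 'a"
  assumes f: "frame D L p r s" and D: "compact D" and e: "0 < e" and g: "frame_growth D p r s e"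
  shows "\<exists>K>0. \<forall>Q J. 2 \<le> Q \<and> 0 < J \<and> 2 * J \<le> Q \<longrightarrow>
     (\<Sum>k\<in>frame_points D p r s J (sqrt (J / Q)) (1 / Q) - {0}.
        measure lborel {t\<in>D. k \<in> frame_box p r s t J (sqrt (J / Q)) (1 / Q)}) \<le> K * sqrt (J / Q) ^ DIM('a) * J powr e"
proof -
  define m where "m = DIM('a)"
  have L: "1 \<le> L" using f by (auto simp: frame_def)
  obtain K0 where K0: "0 < K0" "\<And>Q. 1 \<le> Q \<Longrightarrow> real (card (frame_points D p r s Q 1 (2 / Q))) \<le> K0 * Q powr (m + e)"
    using g unfolding frame_growth_def m_def by blast
  define W where "W = unit_ball_vol m * (2 * L) ^ m"
  have W: "0 < W" using L by (simp add: W_def)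
  \<comment> \<open>The ratio of the geometric series over dyadic sizes; as it exceeds 1, the
    largest size, which is at most \<open>J\<close>, dominates.\<close>
  define q where "q = (2::real) powr e"
  have q: "1 < q" using e by (simp add: q_def)
  define K where "K = W * (K0 * 2 powr (m + e) * (q / (q - 1)))"
  have "0 < K" using W K0 q by (simp add: K_def)
  moreover have "(\<Sum>k\<in>frame_points D p r s J (sqrt (J / Q)) (1 / Q) - {0}.
        measure lborel {t\<in>D. k \<in> frame_box p r s t J (sqrt (J / Q)) (1 / Q)}) \<le> K * sqrt (J / Q) ^ m * J powr e"
    if Q: "2 \<le> Q" and J: "0 < J" "2 * J \<le> Q" for Q J
  proof -
    define b where "b = sqrt (J / Q)"
    have b: "0 < b" "b < 1" using Q J by (auto simp: b_def)
    define X where "X = frame_points D p r s J b (1 / Q) - {0}"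
    have finX: "finite X" unfolding X_def using finite_frame_points[OF f D] by simp
    have X: "fst k \<in> \<int>" "fst k \<noteq> 0" "1 \<le> \<bar>fst k\<bar>" "\<bar>fst k\<bar> \<le> J" if "k \<in> X" for k
    proof -
      show 1: "fst k \<noteq> 0" using frame_points_fst_nonzero[of k D p r s J b "1 / Q"] that b Q by (simp add: X_def)
      show 2: "fst k \<in> \<int>" using that by (cases k) (auto simp: X_def frame_points_def int_points_prod int_points_real)
      show "1 \<le> \<bar>fst k\<bar>" using 1 2 Ints_nonzero_abs_ge1 by blast
      show "\<bar>fst k\<bar> \<le> J" using that by (auto simp: X_def frame_points_def frame_box_def)
    qed
    define i where "i = (\<lambda>k::'a triple. nat \<lfloor>log 2 \<bar>fst k\<bar>\<rfloor>)"
    have i: "2 ^ i k \<le> \<bar>fst k\<bar>" "\<bar>fst k\<bar> \<le> 2 ^ (i k + 1)" if "k \<in> X" for k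
    proof -
      have "0 \<le> log 2 \<bar>fst k\<bar>" using X(3)[OF that] by simp
      then have "real (i k) \<le> log 2 \<bar>fst k\<bar>" "log 2 \<bar>fst k\<bar> < real (i k) + 1" by (auto simp: i_def)
      then have "2 powr (real (i k)) \<le> \<bar>fst k\<bar>" "\<bar>fst k\<bar> \<le> 2 powr (real (i k) + 1)"
        using X(2)[OF that] by (auto simp: le_log_iff log_less_iff)
      then show "2 ^ i k \<le> \<bar>fst k\<bar>" "\<bar>fst k\<bar> \<le> 2 ^ (i k + 1)"
        by (auto simp: powr_realpow powr_add)
    qed
    have group: "(\<Sum>k\<in>X. inverse \<bar>fst k\<bar> ^ m) \<le> K0 * 2 powr (m + e) * (q / (q - 1)) * J powr e"
    proof (cases "X = {}")
      case True
      then show ?thesis using K0 q by simp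
    next
      case False
      define n where "n = Max (i ` X)"
      have n: "i k \<le> n" if "k \<in> X" for k using that finX by (simp add: n_def)
      have "n \<in> i ` X" unfolding n_def using finX False by (intro Max_in) auto
      then have nJ: "2 ^ n \<le> J" using i X(4) by force
      have geo: "(\<Sum>l\<le>n. q ^ l) \<le> (q / (q - 1)) * J powr e"
      proof -
        have "(\<Sum>l\<le>n. q ^ l) = (q ^ Suc n - 1) / (q - 1)"
          using geometric_sum[of q "Suc n"] q by (simp add: lessThan_Suc_atMost)
        also have "\<dots> \<le> (q / (q - 1)) * q ^ n"
          using q by (simp add: divide_right_mono)
        also have "q ^ n = (2 ^ n) powr e"
          unfolding q_def by (simp add: powr_realpow[symmetric] powr_powr mult.commute)
        also have "(q / (q - 1)) * (2 ^ n) powr e \<le> (q / (q - 1)) * J powr e"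
          using nJ e q by (intro mult_left_mono powr_mono2) auto
        finally show ?thesis .
      qed
      have "(\<Sum>k\<in>X. inverse \<bar>fst k\<bar> ^ m) = (\<Sum>l\<le>n. \<Sum>k\<in>{k\<in>X. i k = l}. inverse \<bar>fst k\<bar> ^ m)"
        using n by (intro sum.group[symmetric] finX) auto
      also have "\<dots> \<le> (\<Sum>l\<le>n. K0 * 2 powr (m + e) * q ^ l)"
      proof (rule sum_mono)
        fix l assume l: "l \<in> {..n}"
        define j where "j = (2::real) ^ (l + 1)"
        have j: "1 \<le> j" unfolding j_def by (rule one_le_power) simp
        have lJ: "2 ^ l \<le> J" using l by (intro order_trans[OF power_increasing nJ]) auto
        have "{k\<in>X. i k = l} \<subseteq> frame_points D p r s j 1 (2 / j)"
        proof
          fix k assume k: "k \<in> {k\<in>X. i k = l}"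
          \<comment> \<open>Here \<open>j \<le> 2 * J \<le> Q\<close>, so the vectors of this dyadic
            size are counted by the growth bound at height \<open>j\<close>.\<close>
          have "1 / Q \<le> 2 / j" using lJ J Q by (simp add: j_def field_simps)
          then have "frame_box p r s t J b (1 / Q) \<inter> {k. \<bar>fst k\<bar> \<le> j} \<subseteq> frame_box p r s t j 1 (2 / j)" for t
            using b by (auto simp: frame_box_def)
          moreover have "\<bar>fst k\<bar> \<le> j" using k i(2)[of k] by (auto simp: j_def)
          ultimately show "k \<in> frame_points D p r s j 1 (2 / j)"
            using k unfolding X_def frame_points_def by blast
        qed
        then have "real (card {k\<in>X. i k = l}) \<le> card (frame_points D p r s j 1 (2 / j))"
          using finite_frame_points[OF f D] by (intro of_nat_mono card_mono) auto
        also have "\<dots> \<le> K0 * j powr (m + e)" by (rule K0(2)[OF j])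
        finally have c: "real (card {k\<in>X. i k = l}) \<le> K0 * j powr (m + e)" .
        have "(\<Sum>k\<in>{k\<in>X. i k = l}. inverse \<bar>fst k\<bar> ^ m) \<le> (\<Sum>k\<in>{k\<in>X. i k = l}. inverse (2 ^ l) ^ m)"
        proof (intro sum_mono power_mono)
          fix k assume "k \<in> {k\<in>X. i k = l}"
          then show "inverse \<bar>fst k\<bar> \<le> inverse (2 ^ l)" using i[of k] by (intro le_imp_inverse_le) auto
        qed auto
        also have "\<dots> = card {k\<in>X. i k = l} * inverse (2 ^ l) ^ m" by simp
        also have "\<dots> \<le> K0 * j powr (m + e) * inverse (2 ^ l) ^ m"
          using c by (intro mult_right_mono) auto
        \<comment> \<open>The expected count \<open>(2 ^ l) ^ m\<close> cancels against the decay of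
          the measures; only the excess \<open>q ^ l\<close> remains.\<close>
        also have "j powr (m + e) = 2 powr (m + e) * ((2 ^ l) ^ m * q ^ l)"
        proof -
          have "j powr (m + e) = 2 powr (m + e) * (2 ^ l) powr (m + e)"
            by (simp add: j_def powr_mult)
          also have "(2 ^ l) powr (m + e) = (2 ^ l) ^ m * (2 ^ l) powr e"
            by (simp add: powr_add powr_realpow)
          also have "(2 ^ l) powr e = q ^ l"
            unfolding q_def by (simp add: powr_realpow[symmetric] powr_powr mult.commute)
          finally show ?thesis .
        qed
        also have "K0 * (2 powr (m + e) * ((2 ^ l) ^ m * q ^ l)) * inverse (2 ^ l) ^ m = K0 * 2 powr (m + e) * q ^ l"
          by (simp add: power_inverse field_simps)
        finally show "(\<Sum>k\<in>{k\<in>X. i k = l}. inverse \<bar>fst k\<bar> ^ m) \<le> K0 * 2 powr (m + e) * q ^ l" .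
      qed
      also have "\<dots> = K0 * 2 powr (m + e) * (\<Sum>l\<le>n. q ^ l)" by (simp add: sum_distrib_left)
      also have "\<dots> \<le> K0 * 2 powr (m + e) * ((q / (q - 1)) * J powr e)"
        using geo K0(1) by (intro mult_left_mono) auto
      finally show ?thesis by simp
    qed
    have "(\<Sum>k\<in>X. measure lborel {t\<in>D. k \<in> frame_box p r s t J b (1 / Q)}) \<le> (\<Sum>k\<in>X. W * b ^ m * inverse \<bar>fst k\<bar> ^ m)"
      unfolding W_def m_def using X b by (intro sum_mono measure_frame_times_le[OF f D]) auto
    also have "\<dots> = W * b ^ m * (\<Sum>k\<in>X. inverse \<bar>fst k\<bar> ^ m)" by (simp add: sum_distrib_left)
    also have "\<dots> \<le> W * b ^ m * (K0 * 2 powr (m + e) * (q / (q - 1)) * J powr e)"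
      using group W b by (intro mult_left_mono) auto
    also have "\<dots> = K * b ^ m * J powr e" by (simp add: K_def)
    finally show ?thesis by (simp add: X_def b_def)
  qed
  ultimately show ?thesis unfolding m_def by blast
qed

text \<open>With \<open>J = 1 / \<delta>\<close> the dual sum is at most a constant times
  \<open>sqrt (J / Q) ^ DIM('a) * J powr e\<close>. In dimension at least 2 the first factor is at
  most \<open>J / Q\<close>, and the last lower bound on \<open>\<delta>\<close> says
  \<open>J powr (1 + e) \<le> Q\<close>, so the dual sum is bounded.\<close>

lemma card_frame_points_main:
  fixes a :: "'a::euclidean_space" and p s :: "'a \<Rightarrow> 'a"
  assumes f: "frame (cball a \<rho>) L p r s" and \<rho>: "0 < \<rho>" and m: "2 \<le> DIM('a)" and e: "0 < e"
    and g: "frame_growth (cball a \<rho>) (\<lambda>t. - s t) (\<lambda>t. - r t - p t \<bullet> s t) (\<lambda>t. - p t) e"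
  shows "\<exists>K>0. \<forall>(Q::real) \<delta>::real. 2 \<le> Q \<and> 2 / Q \<le> \<delta> \<and> \<delta> \<le> Q \<and> Q powr (- 1 / (1 + e)) \<le> \<delta> \<longrightarrow>
    real (card (frame_points (cball a \<rho>) p r s Q (sqrt (\<delta> * Q)) \<delta>)) \<le> K * \<delta> * Q ^ (DIM('a) + 1)"
proof -
  define D where "D = cball a \<rho>"
  define p' where "p' = (\<lambda>t. - s t)"
  define r' where "r' = (\<lambda>t. - r t - p t \<bullet> s t)"
  define s' where "s' = (\<lambda>t. - p t)"
  define m where "m = DIM('a)"
  have m2: "2 \<le> m" using m by (simp add: m_def)
  obtain K1 where K1: "0 < K1" "\<And>Q \<delta>. 1 \<le> Q \<Longrightarrow> 0 < \<delta> \<Longrightarrow> \<delta> \<le> Q \<Longrightarrow>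
    real (card (frame_points D p r s Q (sqrt (\<delta> * Q)) \<delta>)) \<le>
      K1 * \<delta> * Q ^ (m + 1) *
       (1 + (\<Sum>k\<in>frame_points D p' r' s' (1 / \<delta>) (1 / sqrt (\<delta> * Q)) (1 / Q) - {0}.
          measure lborel {t \<in> D. k \<in> frame_box p' r' s' t (1 / \<delta>) (1 / sqrt (\<delta> * Q)) (1 / Q)}))"
    using card_frame_points_le[OF f \<rho>] unfolding D_def p'_def r'_def s'_def m_def by blast
  have compD: "compact D" by (simp add: D_def)
  have f2: "frame D (L + L\<^sup>2) p' r' s'"
    unfolding p'_def r'_def s'_def D_def by (rule frame_dual[OF f])
  have g2: "frame_growth D p' r' s' e" using g unfolding p'_def r'_def s'_def D_def .
  obtain K2 where K2: "0 < K2" "\<And>Q J. 2 \<le> Q \<Longrightarrow> 0 < J \<Longrightarrow> 2 * J \<le> Q \<Longrightarrow>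
     (\<Sum>k\<in>frame_points D p' r' s' J (sqrt (J / Q)) (1 / Q) - {0}.
        measure lborel {t\<in>D. k \<in> frame_box p' r' s' t J (sqrt (J / Q)) (1 / Q)}) \<le> K2 * sqrt (J / Q) ^ m * J powr e"
    using sum_measure_frame_times_le[OF f2 compD e g2] unfolding m_def by blast
  define K where "K = K1 * (1 + K2)"
  have "0 < K" using K1 K2 by (simp add: K_def)
  moreover have "real (card (frame_points D p r s Q (sqrt (\<delta> * Q)) \<delta>)) \<le> K * \<delta> * Q ^ (m + 1)"
    if Q: "2 \<le> Q" and \<delta>: "2 / Q \<le> \<delta>" "\<delta> \<le> Q" "Q powr (- 1 / (1 + e)) \<le> \<delta>" for Q \<delta>
  proof -
    define J where "J = 1 / \<delta>"
    have \<delta>0: "0 < \<delta>" using Q \<delta>(1) by (smt (verit) divide_pos_pos)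
    have J: "0 < J" "2 * J \<le> Q" using Q \<delta> \<delta>0 by (auto simp: J_def field_simps)
    have sq: "1 / sqrt (\<delta> * Q) = sqrt (J / Q)" using \<delta>0 Q by (simp add: J_def real_sqrt_divide)
    have "J powr (1 + e) \<le> Q"
    proof -
      have "J \<le> 1 / Q powr (- 1 / (1 + e))" unfolding J_def using \<delta> \<delta>0 Q by (intro divide_left_mono) auto
      also have "\<dots> = Q powr (1 / (1 + e))" by (simp add: powr_minus field_simps)
      finally have "J powr (1 + e) \<le> (Q powr (1 / (1 + e))) powr (1 + e)"
        using J e by (intro powr_mono2) auto
      also have "\<dots> = Q" using e Q by (simp add: powr_powr)
      finally show ?thesis .
    qed
    then have "(J / Q) * J powr e \<le> 1" using J Q by (simp add: powr_add)
    moreover have "sqrt (J / Q) ^ m \<le> J / Q"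
    proof -
      have "sqrt (J / Q) ^ m \<le> sqrt (J / Q) ^ 2"
        using J Q m2 by (intro power_decreasing) auto
      then show ?thesis using J Q by simp
    qed
    ultimately have "sqrt (J / Q) ^ m * J powr e \<le> 1"
      by (smt (verit) mult_right_mono powr_ge_zero)
    then have "K2 * sqrt (J / Q) ^ m * J powr e \<le> K2" using K2(1) by (simp add: mult.assoc)
    with K2(2)[OF Q J] have "(\<Sum>k\<in>frame_points D p' r' s' J (sqrt (J / Q)) (1 / Q) - {0}.
        measure lborel {t\<in>D. k \<in> frame_box p' r' s' t J (sqrt (J / Q)) (1 / Q)}) \<le> K2" by linarith
    then have *: "1 + (\<Sum>k\<in>frame_points D p' r' s' (1 / \<delta>) (1 / sqrt (\<delta> * Q)) (1 / Q) - {0}.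
          measure lborel {t \<in> D. k \<in> frame_box p' r' s' t (1 / \<delta>) (1 / sqrt (\<delta> * Q)) (1 / Q)}) \<le> 1 + K2"
      unfolding sq J_def by simp
    have "real (card (frame_points D p r s Q (sqrt (\<delta> * Q)) \<delta>)) \<le> K1 * \<delta> * Q ^ (m + 1) * (1 + K2)"
      by (rule order_trans[OF K1(2) mult_left_mono[OF *]]) (use Q \<delta> \<delta>0 K1(1) in auto)
    then show ?thesis by (simp add: K_def mult_ac)
  qed
  ultimately show ?thesis unfolding D_def m_def by blast
qed

text \<open>Counting with \<open>\<delta>\<close> of order \<open>Q powr (- 1 / (1 + e))\<close>
  gives the exponent \<open>DIM('a) + 1 - 1 / (1 + e) = DIM('a) + e / (1 + e)\<close>, and the box
  of \<open>frame_growth\<close> is contained in the box counted there.\<close>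

lemma frame_growth_step:
  fixes a :: "'a::euclidean_space" and p s :: "'a \<Rightarrow> 'a"
  assumes f: "frame (cball a \<rho>) L p r s" and \<rho>: "0 < \<rho>" and m: "2 \<le> DIM('a)" and e: "0 < e"
    and g: "frame_growth (cball a \<rho>) (\<lambda>t. - s t) (\<lambda>t. - r t - p t \<bullet> s t) (\<lambda>t. - p t) e"
  shows "frame_growth (cball a \<rho>) p r s (e / (1 + e))"
proof -
  define D where "D = cball a \<rho>"
  define m where "m = DIM('a)"
  have f1: "frame D L p r s" using f by (simp add: D_def)
  obtain K where K: "0 < K" "\<And>Q \<delta>. 2 \<le> Q \<Longrightarrow> 2 / Q \<le> \<delta> \<Longrightarrow> \<delta> \<le> Q \<Longrightarrow> Q powr (- 1 / (1 + e)) \<le> \<delta> \<Longrightarrow>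
    real (card (frame_points D p r s Q (sqrt (\<delta> * Q)) \<delta>)) \<le> K * \<delta> * Q ^ (m + 1)"
    using card_frame_points_main[OF assms] unfolding D_def m_def by blast
  define K' where "K' = 2 * K + card (frame_points D p r s 2 1 2)"
  have "0 < K'" using K by (simp add: K'_def)
  have fin: "finite (frame_points D p r s Q B G)" for Q B G
    using finite_frame_points[OF f1] by (simp add: D_def)
  have mono: "card (frame_points D p r s Q B G) \<le> card (frame_points D p r s Q' B' G')" if "Q \<le> Q'" "B \<le> B'" "G \<le> G'" for Q B G Q' B' G'
    using frame_box_scale[OF that, of p r s] by (intro card_mono fin) (auto simp: frame_points_def)
  have "real (card (frame_points D p r s Q 1 (2 / Q))) \<le> K' * Q powr (m + e / (1 + e))" if Q: "1 \<le> Q" for Q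
  proof (cases "2 \<le> Q")
    case True
    \<comment> \<open>The factor 2 secures \<open>2 / Q \<le> \<delta>\<close>, which also makes the
      tangential width \<open>sqrt (\<delta> * Q)\<close> at least 1.\<close>
    define \<delta> where "\<delta> = 2 * Q powr (- 1 / (1 + e))"
    have "Q powr - 1 \<le> Q powr (- 1 / (1 + e))" using e Q by (intro powr_mono) (auto simp: field_simps)
    then have 1: "2 / Q \<le> \<delta>" using Q by (simp add: \<delta>_def powr_minus field_simps)
    have "Q powr (- 1 / (1 + e)) \<le> Q powr 0" using e Q by (intro powr_mono) (auto simp: field_simps)
    then have 2: "\<delta> \<le> Q" using True by (simp add: \<delta>_def)
    have "2 \<le> \<delta> * Q" using 1 Q by (simp add: field_simps)
    then have "1 \<le> sqrt (\<delta> * Q)" by simp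
    then have "card (frame_points D p r s Q 1 (2 / Q)) \<le> card (frame_points D p r s Q (sqrt (\<delta> * Q)) \<delta>)"
      by (intro mono 1) auto
    also have "real (card (frame_points D p r s Q (sqrt (\<delta> * Q)) \<delta>)) \<le> K * \<delta> * Q ^ (m + 1)"
      by (rule K(2)[OF True 1 2]) (simp add: \<delta>_def)
    also have "\<dots> = 2 * K * (Q powr (- 1 / (1 + e)) * Q powr (m + 1))"
      using Q by (simp add: \<delta>_def powr_realpow[symmetric] powr_add)
    also have "Q powr (- 1 / (1 + e)) * Q powr (m + 1) = Q powr (m + e / (1 + e))"
      unfolding powr_add[symmetric] using e by (intro arg_cong[where f = "\<lambda>x. Q powr x"]) (simp add: field_simps)
    also have "2 * K * Q powr (m + e / (1 + e)) \<le> K' * Q powr (m + e / (1 + e))"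
      by (intro mult_right_mono) (auto simp: K'_def)
    finally show ?thesis by simp
  next
    case False
    have "2 / Q \<le> 2" using Q by (simp add: field_simps)
    then have "card (frame_points D p r s Q 1 (2 / Q)) \<le> card (frame_points D p r s 2 1 2)"
      using False by (intro mono) auto
    also have "real (card (frame_points D p r s 2 1 2)) \<le> K' * 1" using K by (simp add: K'_def)
    also have "\<dots> \<le> K' * Q powr (m + e / (1 + e))"
      using Q e \<open>0 < K'\<close> by (intro mult_left_mono ge_one_powr_ge_zero) auto
    finally show ?thesis by simp
  qed
  then show ?thesis unfolding frame_growth_def m_def[symmetric] D_def[symmetric] using \<open>0 < K'\<close> by blast
qed

text \<open>The trivial count: all boxes lie in a ball of radius of order \<open>Q\<close> in a
  space of dimension \<open>DIM('a) + 2\<close>, which is excess 2.\<close>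

lemma frame_growth_base:
  fixes p s :: "'a::euclidean_space \<Rightarrow> 'a"
  assumes f: "frame D L p r s" and D: "compact D"
  shows "frame_growth D p r s 2"
proof -
  obtain K where K: "1 \<le> K" "\<forall>t\<in>D. \<forall>Q B G v. v \<in> frame_box p r s t Q B G \<longrightarrow> norm v \<le> K * (Q + B + G)"
    using frame_box_bounded[OF assms] by blast
  define m where "m = DIM('a)"
  have "real (card (frame_points D p r s Q 1 (2 / Q))) \<le> (9 * K) ^ (m + 2) * Q powr (m + 2)" if Q: "1 \<le> Q" for Q
  proof -
    have "2 / Q \<le> 2" using Q by (simp add: field_simps)
    then have "K * (Q + 1 + 2 / Q) \<le> K * (4 * Q)" using Q K(1) by (intro mult_left_mono) auto
    then have "frame_points D p r s Q 1 (2 / Q) \<subseteq> int_points \<inter> {z. norm z \<le> 4 * K * Q}"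
      using K(2) by (fastforce simp: frame_points_def)
    moreover have "finite (int_points \<inter> {z::'a triple. norm z \<le> 4 * K * Q})"
      using finite_int_points_bounded[of "{z::'a triple. norm z \<le> 4 * K * Q}"] 
      by (simp add: Int_commute bounded_iff) blast
    ultimately have "card (frame_points D p r s Q 1 (2 / Q)) \<le> card (int_points \<inter> {z::'a triple. norm z \<le> 4 * K * Q})"
      by (rule card_mono[rotated])
    also have "real (card (int_points \<inter> {z::'a triple. norm z \<le> 4 * K * Q})) \<le> (2 * (4 * K * Q) + 1) ^ DIM('a triple)"
      using K(1) Q by (intro card_int_points_ball) auto
    also have "DIM('a triple) = m + 2" by (simp add: m_def)
    also have "(2 * (4 * K * Q) + 1) ^ (m + 2) \<le> (9 * K * Q) ^ (m + 2)"
      using K(1) Q mult_mono[OF K(1) Q] by (intro power_mono) auto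
    also have "\<dots> = (9 * K) ^ (m + 2) * Q powr (m + 2)"
      using Q unfolding power_mult_distrib by (subst powr_realpow) (auto simp: powr_realpow[symmetric])
    finally show ?thesis by simp
  qed
  moreover have "0 < (9 * K) ^ (m + 2)" using K(1) by simp
  ultimately show ?thesis unfolding frame_growth_def m_def by (metis of_nat_add of_nat_numeral)
qed

text \<open>Each step adds 1 to \<open>1 / e\<close>, starting from 1/2; this gives the closed form.
  A step needs the bound for the dual frame, so the induction runs over all frames on the ball at
  once.\<close>

lemma frame_growth_all:
  fixes a :: "'a::euclidean_space" and p s :: "'a \<Rightarrow> 'a"
  assumes "frame (cball a \<rho>) L p r s" and \<rho>: "0 < \<rho>" and m: "2 \<le> DIM('a)"
  shows "frame_growth (cball a \<rho>) p r s (2 / (2 * real n + 1))"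
  using assms(1)
proof (induction n arbitrary: L p r s)
  case 0
  then show ?case using frame_growth_base[of "cball a \<rho>" L p r s] by simp
next
  case (Suc n)
  define e where "e = 2 / (2 * real n + 1)"
  have e: "0 < e" by (simp add: e_def)
  have "frame_growth (cball a \<rho>) p r s (e / (1 + e))"
    unfolding e_def
    by (rule frame_growth_step[OF Suc.prems \<rho> m _ Suc.IH[OF frame_dual[OF Suc.prems]]]) simp
  moreover have "1 + e = (2 * real n + 3) / (2 * real n + 1)"
    by (simp add: e_def field_simps)
  then have "e / (1 + e) = 2 / (2 * real n + 3)"
    by (simp only: e_def divide_divide_eq_right divide_divide_eq_left) (simp add: divide_simps)
  then have "e / (1 + e) = 2 / (2 * real (Suc n) + 1)" by (simp add: algebra_simps)
  ultimately show ?case by simp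
qed

text \<open>After enough iterations the excess \<open>e\<close> of the dual frame satisfies
  \<open>\<theta> \<le> 1 / (1 + e)\<close>, and then \<open>Q powr (- \<theta>)\<close> is above
  the threshold in \<open>card_frame_points_main\<close>.\<close>

theorem card_frame_points_sharp:
  fixes a :: "'a::euclidean_space" and p s :: "'a \<Rightarrow> 'a"
  assumes f: "frame (cball a \<rho>) L p r s" and \<rho>: "0 < \<rho>" and m: "2 \<le> DIM('a)" and \<theta>: "0 < \<theta>" "\<theta> < 1"
  shows "\<exists>K>0. \<forall>(Q::real) \<delta>::real. 2 \<le> Q \<and> 2 / Q \<le> \<delta> \<and> \<delta> \<le> Q \<and> Q powr (- \<theta>) \<le> \<delta> \<longrightarrow>
    real (card (frame_points (cball a \<rho>) p r s Q (sqrt (\<delta> * Q)) \<delta>)) \<le> K * \<delta> * Q ^ (DIM('a) + 1)"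
proof -
  have "0 < (1 - \<theta>) / \<theta>" using \<theta> by simp
  then obtain n :: nat where n: "2 / ((1 - \<theta>) / \<theta>) \<le> real n" using real_arch_simple by blast
  define e where "e = 2 / (2 * real n + 1)"
  have e: "0 < e" by (simp add: e_def)
  have "2 \<le> real n * ((1 - \<theta>) / \<theta>)" using n by (simp only: pos_divide_le_eq[OF \<open>0 < (1 - \<theta>) / \<theta>\<close>])
  also have "\<dots> \<le> (2 * real n + 1) * ((1 - \<theta>) / \<theta>)" using \<open>0 < (1 - \<theta>) / \<theta>\<close> by (intro mult_right_mono) auto
  finally have "e \<le> (1 - \<theta>) / \<theta>" by (simp add: e_def pos_divide_le_eq mult.commute)
  then have "\<theta> \<le> 1 / (1 + e)" using \<theta> e by (simp add: field_simps)
  then have *: "Q powr (- 1 / (1 + e)) \<le> Q powr (- \<theta>)" if "2 \<le> Q" for Q :: real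
    using that by (intro powr_mono) auto
  have "frame_growth (cball a \<rho>) (\<lambda>t. - s t) (\<lambda>t. - r t - p t \<bullet> s t) (\<lambda>t. - p t) e"
    unfolding e_def by (rule frame_growth_all[OF frame_dual[OF f] \<rho> m])
  from card_frame_points_main[OF f \<rho> m e this] show ?thesis
    using * order_trans by meson
qed

section \<open>The frame of a graph\<close>

definition gradient :: "(real ^ 'm \<Rightarrow> real) \<Rightarrow> real ^ 'm \<Rightarrow> real ^ 'm::finite" where
  "gradient f x = (\<chi> i. partial_deriv i f x)"

lemma frechet_derivative_partial_deriv:
  fixes f :: "real ^ 'm::finite \<Rightarrow> real"
  assumes "f differentiable (at x)"
  shows "frechet_derivative f (at x) h = (\<Sum>i\<in>UNIV. h $ i * partial_deriv i f x)"
proof -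
  have l: "linear (frechet_derivative f (at x))" using assms by (rule linear_frechet_derivative)
  have "frechet_derivative f (at x) h = frechet_derivative f (at x) (\<Sum>i\<in>UNIV. h $ i *\<^sub>R axis i 1)"
    using basis_expansion[of h] by (simp add: scalar_mult_eq_scaleR)
  also have "\<dots> = (\<Sum>i\<in>UNIV. h $ i * partial_deriv i f x)"
    by (simp add: linear_sum[OF l] linear_cmul[OF l] partial_deriv_def)
  finally show ?thesis .
qed

lemma has_derivative_gradient_inner:
  fixes f :: "real ^ 'm::finite \<Rightarrow> real"
  assumes "f differentiable (at x)"
  shows "(f has_derivative (\<lambda>h. gradient f x \<bullet> h)) (at x)"
proof -
  have "(f has_derivative frechet_derivative f (at x)) (at x)"
    using assms by (simp add: frechet_derivative_works)
  also have "frechet_derivative f (at x) = (\<lambda>h. gradient f x \<bullet> h)"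
    by (auto simp: frechet_derivative_partial_deriv[OF assms] gradient_def inner_vec_def mult.commute)
  finally show ?thesis .
qed

text \<open>\<open>hessian\<close> has the variable of the outer derivative as row index, whereas
  the Jacobian of the gradient has it as column index; hence the transpose, which leaves the
  determinant unchanged.\<close>

lemma has_derivative_gradient:
  fixes f :: "real ^ 'm::finite \<Rightarrow> real"
  assumes "\<And>i. partial_deriv i f differentiable (at x)"
  shows "(gradient f has_derivative (\<lambda>h. transpose (hessian f x) *v h)) (at x)"
proof (subst has_derivative_componentwise_within, rule ballI)
  fix b :: "real ^ 'm" assume "b \<in> Basis"
  then obtain j where b: "b = axis j 1" by (auto simp: Basis_vec_def)
  have "(partial_deriv j f has_derivative (\<lambda>h. gradient (partial_deriv j f) x \<bullet> h)) (at x)"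
    by (rule has_derivative_gradient_inner[OF assms])
  moreover have "gradient f y \<bullet> b = partial_deriv j f y" for y
    by (simp add: b gradient_def inner_axis)
  moreover have "(transpose (hessian f x) *v h) \<bullet> b = gradient (partial_deriv j f) x \<bullet> h" for h
    unfolding b cart_eq_inner_axis[symmetric]
    by (simp add: matrix_vector_mult_def transpose_def hessian_def gradient_def inner_vec_def)
  ultimately show "((\<lambda>x. gradient f x \<bullet> b) has_derivative (\<lambda>h. (transpose (hessian f x) *v h) \<bullet> b)) (at x)"
    by simp
qed

text \<open>Near \<open>x0\<close> the gradient map is an invertible linear map plus a perturbation
  of small Lipschitz constant, so it is bi-Lipschitz. The remaining frame condition is a
  second-order Taylor estimate.\<close>

lemma frame_graph:
  fixes f :: "real ^ 'm::finite \<Rightarrow> real"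
  assumes U: "open U" "x0 \<in> U" and f: "Ck_on 2 U f" and det: "det (hessian f x0) \<noteq> 0"
  shows "\<exists>\<rho>>0. \<exists>L. cball x0 \<rho> \<subseteq> U \<and> frame (cball x0 \<rho>) L (\<lambda>t. t) (\<lambda>t. f t - gradient f t \<bullet> t) (gradient f)"
proof -
  define g where "g = gradient f"
  define A where "A = (\<lambda>x. transpose (hessian f x))"
  have d1: "f differentiable (at x)" if "x \<in> U" for x
    using f that by (simp add: numeral_2_eq_2)
  have d2: "partial_deriv i f differentiable (at x)" if "x \<in> U" for x i
    using f that unfolding partial_deriv_def[abs_def] by (simp add: numeral_2_eq_2)
  have d3: "continuous_on U (\<lambda>x. hessian f x $ i $ j)" for i j
    using f unfolding hessian_def partial_deriv_def[abs_def] by (simp add: numeral_2_eq_2)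
  have fd: "(f has_derivative (\<lambda>h. g x \<bullet> h)) (at x)" if "x \<in> U" for x
    unfolding g_def by (rule has_derivative_gradient_inner[OF d1[OF that]])
  have gd: "(g has_derivative (*v) (A x)) (at x)" if "x \<in> U" for x
    unfolding g_def A_def by (rule has_derivative_gradient[OF d2[OF that]])
  define A0 where "A0 = A x0"
  have "invertible A0" using det by (simp add: A0_def A_def invertible_det_nz)
  then have "inj ((*v) A0)" by (rule inj_matrix_vector_mult)
  then obtain c where c: "0 < c" "\<And>h. c * norm h \<le> norm (A0 *v h)"
    using linear_inj_bounded_below_pos[of "(*v) A0"] matrix_vector_mul_linear by blast
  \<comment> \<open>\<open>E\<close> bounds the operator norm of \<open>A x - A0\<close> through the
    matrix entries. Keeping it at most half of the lower bound \<open>c\<close> of \<open>A0\<close>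
    leaves \<open>c / 2\<close> for the gradient map.\<close>
  define E where "E = (\<lambda>x. \<Sum>i\<in>UNIV. \<Sum>j\<in>UNIV. \<bar>(A x - A0) $ i $ j\<bar>)"
  have "continuous_on U E"
  proof -
    have "E = (\<lambda>x. \<Sum>i\<in>UNIV. \<Sum>j\<in>UNIV. \<bar>hessian f x $ j $ i - A0 $ i $ j\<bar>)"
      by (simp add: E_def A_def transpose_def)
    then show ?thesis by (auto intro!: continuous_intros d3)
  qed
  then have "isCont E x0" using U continuous_on_eq_continuous_at by blast
  moreover have "E x0 = 0" by (simp add: E_def A0_def)
  ultimately have "\<forall>\<^sub>F x in at x0. E x < c / 2"
    using c(1) order_tendstoD(2)[of E "E x0" "at x0" "c / 2"] by (simp add: isCont_def)
  then obtain d where d: "0 < d" "\<And>x. x \<noteq> x0 \<Longrightarrow> dist x x0 < d \<Longrightarrow> E x < c / 2"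
    unfolding eventually_at by blast
  obtain d' where d': "0 < d'" "cball x0 d' \<subseteq> U"
    using U open_contains_cball by blast
  define \<rho> where "\<rho> = min (d / 2) d'"
  have \<rho>: "0 < \<rho>" using d d' by (simp add: \<rho>_def)
  define D where "D = cball x0 \<rho>"
  have DU: "D \<subseteq> U" using d' by (auto simp: D_def \<rho>_def)
  have ED: "E x \<le> c / 2" if "x \<in> D" for x
  proof (cases "x = x0")
    case False
    have "dist x x0 < d" using that d(1) by (auto simp: D_def \<rho>_def dist_commute)
    then show ?thesis using d(2)[OF False] by simp
  qed (use \<open>E x0 = 0\<close> c in simp)
  have on: "onorm ((*v) (A x - A0)) \<le> c / 2" if "x \<in> D" for x
    using onorm_le_matrix_component_sum[of "A x - A0"] ED[OF that] by (simp add: E_def)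
  have near: "norm ((g t - A0 *v t) - (g u - A0 *v u)) \<le> c / 2 * norm (t - u)" if "t \<in> D" "u \<in> D" for t u
  proof (rule differentiable_bound[of D "\<lambda>t. g t - A0 *v t" "\<lambda>x. (*v) (A x - A0)"])
    fix x assume x: "x \<in> D"
    have "((\<lambda>t. g t - A0 *v t) has_derivative (\<lambda>h. A x *v h - A0 *v h)) (at x within D)"
      using has_derivative_at_withinI[OF gd, of x D] DU x
      by (intro has_derivative_diff bounded_linear.has_derivative[OF matrix_vector_mul_bounded_linear] has_derivative_ident) auto
    moreover have "(*v) (A x - A0) = (\<lambda>h. A x *v h - A0 *v h)"
      by (simp add: fun_eq_iff matrix_vector_mult_diff_rdistrib)
    ultimately show "((\<lambda>t. g t - A0 *v t) has_derivative (*v) (A x - A0)) (at x within D)"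
      by simp
  qed (use on that in \<open>auto simp: D_def\<close>)
  define N where "N = onorm ((*v) A0)"
  have N: "0 \<le> N" "\<And>h. norm (A0 *v h) \<le> N * norm h"
    unfolding N_def using onorm[OF matrix_vector_mul_bounded_linear] onorm_pos_le[OF matrix_vector_mul_bounded_linear] by blast+
  define L where "L = 1 + 2 / c + N + c / 2"
  have L: "1 \<le> L" "2 / c \<le> L" "N + c / 2 \<le> L" using c N by (auto simp: L_def)
  have g1: "norm (g t - g u) \<le> L * norm (t - u)" and g2: "norm (t - u) \<le> L * norm (g t - g u)" if tu: "t \<in> D" "u \<in> D" for t u
  proof -
    have e: "g t - g u = ((g t - A0 *v t) - (g u - A0 *v u)) + A0 *v (t - u)"
      by (simp add: matrix_vector_mult_diff_distrib)
    have "norm (g t - g u) \<le> c / 2 * norm (t - u) + N * norm (t - u)"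
      unfolding e by (rule order_trans[OF norm_triangle_ineq add_mono[OF near[OF tu] N(2)]])
    also have "\<dots> = (N + c / 2) * norm (t - u)" by (simp add: algebra_simps)
    also have "\<dots> \<le> L * norm (t - u)" by (rule mult_right_mono[OF L(3)]) simp
    finally show "norm (g t - g u) \<le> L * norm (t - u)" .
    have "A0 *v (t - u) = (g t - g u) - ((g t - A0 *v t) - (g u - A0 *v u))" unfolding e by simp
    then have "norm (A0 *v (t - u)) \<le> norm (g t - g u) + norm ((g t - A0 *v t) - (g u - A0 *v u))"
      using norm_triangle_ineq4 by metis
    then have "c * norm (t - u) \<le> norm (g t - g u) + c / 2 * norm (t - u)"
      using c(2)[of "t - u"] near[OF tu] by linarith
    then have "norm (t - u) \<le> (2 / c) * norm (g t - g u)" using c(1) by (simp add: field_simps)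
    also have "\<dots> \<le> L * norm (g t - g u)" by (rule mult_right_mono[OF L(2)]) simp
    finally show "norm (t - u) \<le> L * norm (g t - g u)" .
  qed
  have taylor: "\<bar>f t - f u - g u \<bullet> (t - u)\<bar> \<le> L * (norm (t - u))\<^sup>2" if tu: "t \<in> D" "u \<in> D" for t u
  proof -
    have seg: "closed_segment t u \<subseteq> D" using tu by (auto simp: D_def intro: closed_segment_subset convex_cball[THEN convex_contains_segment[THEN iffD1, rule_format], THEN subsetD])
    \<comment> \<open>Mean value inequality for \<open>f\<close> minus its linear part at
      \<open>u\<close>: on the segment the gradient of this function is \<open>g y - g u\<close>, of
      norm at most \<open>L * norm (t - u)\<close>.\<close>
    have "norm ((f t - g u \<bullet> t) - (f u - g u \<bullet> u)) \<le> (L * norm (t - u)) * norm (t - u)"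
    proof (rule differentiable_bound[of "closed_segment t u" "\<lambda>y. f y - g u \<bullet> y" "\<lambda>y h. (g y - g u) \<bullet> h"])
      fix y assume y: "y \<in> closed_segment t u"
      then have yD: "y \<in> D" using seg by blast
      have "((\<lambda>y. f y - g u \<bullet> y) has_derivative (\<lambda>h. g y \<bullet> h - g u \<bullet> h)) (at y within closed_segment t u)"
        using has_derivative_at_withinI[OF fd, of y "closed_segment t u"] DU yD
        by (intro has_derivative_diff has_derivative_inner_right has_derivative_ident) auto
      then show "((\<lambda>y. f y - g u \<bullet> y) has_derivative (\<lambda>h. (g y - g u) \<bullet> h)) (at y within closed_segment t u)"
        by (simp add: inner_diff_left)
      have "norm (g y - g u) \<le> L * norm (y - u)" by (rule g1[OF yD tu(2)])
      also have "\<dots> \<le> L * norm (t - u)"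
        using L(1) segment_bound[OF y] by (intro mult_left_mono) (auto simp: norm_minus_commute)
      finally have b: "norm (g y - g u) \<le> L * norm (t - u)" .
      show "onorm (\<lambda>h. (g y - g u) \<bullet> h) \<le> L * norm (t - u)"
      proof (rule onorm_le)
        fix h
        have "\<bar>(g y - g u) \<bullet> h\<bar> \<le> norm (g y - g u) * norm h" by (rule Cauchy_Schwarz_ineq2)
        also have "\<dots> \<le> L * norm (t - u) * norm h" by (rule mult_right_mono[OF b]) simp
        finally show "norm ((g y - g u) \<bullet> h) \<le> L * norm (t - u) * norm h" by simp
      qed
    qed auto
    then show ?thesis by (simp add: inner_diff_right power2_eq_square algebra_simps)
  qed
  have "continuous_on D f" "continuous_on D g"
    using has_derivative_continuous[OF fd] has_derivative_continuous[OF gd] DU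
    by (auto intro!: continuous_at_imp_continuous_on)
  then have "continuous_on D (\<lambda>t. f t - g t \<bullet> t)" by (intro continuous_intros)
  moreover have "\<bar>(f u - g u \<bullet> u) - (f t - g t \<bullet> t) + t \<bullet> (g u - g t)\<bar> \<le> L * (norm (t - u))\<^sup>2" if "t \<in> D" "u \<in> D" for t u
  proof -
    have "(f u - g u \<bullet> u) - (f t - g t \<bullet> t) + t \<bullet> (g u - g t) = - (f t - f u - g u \<bullet> (t - u))"
      by (simp add: inner_diff_right inner_commute)
    then show ?thesis using taylor[OF that] by simp
  qed
  moreover have "norm (t - u) \<le> L * norm (t - u)" for t u :: "real ^ 'm"
    using mult_right_mono[OF L(1), of "norm (t - u)"] by simp
  ultimately have "frame D L (\<lambda>t. t) (\<lambda>t. f t - g t \<bullet> t) g"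
    unfolding frame_def using L(1) g1 g2 by blast
  then show ?thesis using \<rho> DU unfolding D_def g_def by blast
qed

section \<open>Hausdorff null sets\<close>

text \<open>Covers with two indices suit countable unions and covers built level by level; a
  bijection between pairs and natural numbers turns them into sequences.\<close>

lemma hausdorff_measure_eq_0I:
  fixes A :: "'a::metric_space set"
  assumes "\<And>\<delta> e::real. 0 < \<delta> \<Longrightarrow> 0 < e \<Longrightarrow> \<exists>U::nat \<Rightarrow> nat \<Rightarrow> 'a set.
     A \<subseteq> (\<Union>k. \<Union>i. U k i) \<and> (\<forall>k i. bounded (U k i) \<and> diameter (U k i) \<le> \<delta>) \<and>
     (\<Sum>k. \<Sum>i. hausdorff_gauge s (U k i)) \<le> ennreal e"
  shows "hausdorff_measure s A = 0"
proof -
  have "hausdorff_premeasure s \<delta> A \<le> 0" if \<delta>: "0 < \<delta>" for \<delta>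
  proof (rule ennreal_le_epsilon)
    fix e :: real assume e: "0 < e"
    obtain U :: "nat \<Rightarrow> nat \<Rightarrow> 'a set" where U: "A \<subseteq> (\<Union>k. \<Union>i. U k i)" "\<And>k i. bounded (U k i) \<and> diameter (U k i) \<le> \<delta>"
      "(\<Sum>k. \<Sum>i. hausdorff_gauge s (U k i)) \<le> ennreal e"
      using assms[OF \<delta> e] by blast
    define V where "V = (\<lambda>n. case prod_decode n of (k, i) \<Rightarrow> U k i)"
    have V: "V (prod_encode (k, i)) = U k i" for k i by (simp add: V_def)
    have "A \<subseteq> (\<Union>n. V n)"
    proof
      fix x assume "x \<in> A"
      then obtain k i where "x \<in> U k i" using U(1) by blast
      then have "x \<in> V (prod_encode (k, i))" by (simp only: V)
      then show "x \<in> (\<Union>n. V n)" by blast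
    qed
    moreover have "bounded (V n) \<and> diameter (V n) \<le> \<delta>" for n
      using U(2) by (simp add: V_def split: prod.split)
    ultimately have "hausdorff_premeasure s \<delta> A \<le> (\<Sum>n. hausdorff_gauge s (V n))"
      unfolding hausdorff_premeasure_def by (intro INF_lower) auto
    also have "\<dots> = (\<Sum>n. (\<lambda>(k, i). hausdorff_gauge s (U k i)) (prod_decode n))"
      by (intro suminf_cong) (simp add: V_def split: prod.split)
    also have "\<dots> = (\<Sum>k. \<Sum>i. hausdorff_gauge s (U k i))"
      by (intro suminf_ennreal_2dimen) simp
    also have "\<dots> \<le> 0 + ennreal e" using U(3) by simp
    finally show "hausdorff_premeasure s \<delta> A \<le> 0 + ennreal e" .
  qed
  then show ?thesis unfolding hausdorff_measure_def by (auto intro!: antisym SUP_least)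
qed

lemma hausdorff_measure_eq_0D:
  fixes A :: "'a::metric_space set"
  assumes "hausdorff_measure s A = 0" and \<delta>: "0 < \<delta>" and e: "0 < (e::ennreal)"
  shows "\<exists>U::nat \<Rightarrow> 'a set. A \<subseteq> (\<Union>i. U i) \<and> (\<forall>i. bounded (U i) \<and> diameter (U i) \<le> \<delta>) \<and> (\<Sum>i. hausdorff_gauge s (U i)) \<le> e"
proof -
  have "hausdorff_premeasure s \<delta> A \<le> hausdorff_measure s A"
    unfolding hausdorff_measure_def using \<delta> by (intro SUP_upper) auto
  then have "hausdorff_premeasure s \<delta> A < e" using assms(1) e by simp
  then show ?thesis unfolding hausdorff_premeasure_def INF_less_iff by (auto intro: less_imp_le)
qed

lemma hausdorff_measure_UN_eq_0:
  fixes A :: "nat \<Rightarrow> 'a::metric_space set"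
  assumes "\<And>k. hausdorff_measure s (A k) = 0"
  shows "hausdorff_measure s (\<Union>k. A k) = 0"
proof (rule hausdorff_measure_eq_0I)
  fix \<delta> e :: real assume \<delta>: "0 < \<delta>" and e: "0 < e"
  have "\<forall>k. \<exists>U::nat \<Rightarrow> 'a set. A k \<subseteq> (\<Union>i. U i) \<and> (\<forall>i. bounded (U i) \<and> diameter (U i) \<le> \<delta>) \<and> (\<Sum>i. hausdorff_gauge s (U i)) \<le> ennreal (e * (1 / 2) ^ Suc k)"
    using hausdorff_measure_eq_0D[OF assms \<delta>] e by simp
  then obtain U :: "nat \<Rightarrow> nat \<Rightarrow> 'a set" where U: "\<And>k. A k \<subseteq> (\<Union>i. U k i)" "\<And>k i. bounded (U k i) \<and> diameter (U k i) \<le> \<delta>"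
     "\<And>k. (\<Sum>i. hausdorff_gauge s (U k i)) \<le> ennreal (e * (1 / 2) ^ Suc k)" by metis
  have cov: "(\<Union>k. A k) \<subseteq> (\<Union>k. \<Union>i. U k i)"
    by (intro UN_mono subset_refl U(1))
  have "(\<Sum>k. \<Sum>i. hausdorff_gauge s (U k i)) \<le> (\<Sum>k. ennreal (e * (1 / 2) ^ Suc k))"
    using U(3) by (intro suminf_le) auto
  also have "\<dots> = ennreal e"
    using e sums_mult[OF power_half_series, of e] by (intro suminf_ennreal_eq) auto
  finally show "\<exists>U::nat \<Rightarrow> nat \<Rightarrow> 'a set. (\<Union>k. A k) \<subseteq> (\<Union>k. \<Union>i. U k i) \<and> (\<forall>k i. bounded (U k i) \<and> diameter (U k i) \<le> \<delta>) \<and>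
     (\<Sum>k. \<Sum>i. hausdorff_gauge s (U k i)) \<le> ennreal e"
    using cov U(2) by (intro exI[of _ U]) simp
qed

lemma hausdorff_measure_mono_0:
  assumes "hausdorff_measure s B = 0" "A \<subseteq> B"
  shows "hausdorff_measure s A = 0"
proof -
  have "hausdorff_premeasure s \<delta> A \<le> hausdorff_premeasure s \<delta> B" for \<delta>
    unfolding hausdorff_premeasure_def using assms(2) by (intro INF_superset_mono) auto
  then have "hausdorff_measure s A \<le> hausdorff_measure s B"
    unfolding hausdorff_measure_def by (intro SUP_mono) auto
  then show ?thesis using assms(1) by simp
qed

lemma hausdorff_measure_singleton: "0 < s \<Longrightarrow> hausdorff_measure s {x} = 0"
  by (rule hausdorff_measure_eq_0I, rule exI[of _ "\<lambda>_ _. {x}"]) (auto simp: hausdorff_gauge_def)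

text \<open>The Hausdorff-Cantelli lemma: the levels from \<open>l0\<close> on cover
  \<open>A\<close>, their cost is a tail of a convergent series, and their diameters are small
  because \<open>d\<close> tends to 0.\<close>

lemma hausdorff_cantelli:
  fixes U :: "nat \<Rightarrow> 'v \<Rightarrow> 'a::metric_space set"
  assumes s: "0 < s" and V: "\<And>l. finite (V l)" and d0: "\<And>l. 0 \<le> d l"
    and U: "\<And>l v. v \<in> V l \<Longrightarrow> bounded (U l v) \<and> diameter (U l v) \<le> d l"
    and d: "d \<longlonglongrightarrow> 0" and sum: "summable (\<lambda>l. card (V l) * d l powr s)"
    and A: "\<And>x l0. x \<in> A \<Longrightarrow> \<exists>l\<ge>l0. \<exists>v\<in>V l. x \<in> U l v"
  shows "hausdorff_measure s A = 0"
proof (rule hausdorff_measure_eq_0I)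
  fix \<delta> e :: real assume \<delta>: "0 < \<delta>" and e: "0 < e"
  define a where "a = (\<lambda>l. card (V l) * d l powr s)"
  obtain l1 where l1: "\<And>l. l \<ge> l1 \<Longrightarrow> d l < \<delta>"
    using order_tendstoD(2)[OF d \<delta>] unfolding eventually_sequentially by blast
  obtain l2 where l2: "\<And>l. l \<ge> l2 \<Longrightarrow> norm (\<Sum>i. a (i + l)) < e"
    using suminf_exist_split[OF e sum] unfolding a_def by blast
  define l0 where "l0 = max l1 l2"
  have "\<exists>h. bij_betw h {0..<card (V l)} (V l)" for l
    by (rule ex_bij_betw_nat_finite[OF V])
  then obtain h where h: "\<And>l. bij_betw (h l) {0..<card (V l)} (V l)" by metis
  \<comment> \<open>Each finite level becomes a sequence, padded with empty sets, whose gauge is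
    0.\<close>
  define W where "W = (\<lambda>k i. if i < card (V (k + l0)) then U (k + l0) (h (k + l0) i) else {})"
  have hV: "h l i \<in> V l" if "i < card (V l)" for l i
    using bij_betwE[OF h[of l]] that by auto
  have cov: "A \<subseteq> (\<Union>k. \<Union>i. W k i)"
  proof
    fix x assume "x \<in> A"
    then obtain l v where l: "l \<ge> l0" "v \<in> V l" "x \<in> U l v" using A by blast
    then obtain i where i: "i < card (V l)" "v = h l i"
      using bij_betw_imp_surj_on[OF h[of l]] by (metis atLeastLessThan_iff imageE)
    then have "x \<in> W (l - l0) i" using l by (simp add: W_def)
    then show "x \<in> (\<Union>k. \<Union>i. W k i)" by blast
  qed
  have bd: "bounded (W k i) \<and> diameter (W k i) \<le> \<delta>" for k i
  proof -
    have "l1 \<le> k + l0" by (simp add: l0_def)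
    from l1[OF this] have "d (k + l0) \<le> \<delta>" by simp
    then show ?thesis using U[OF hV, of i "k + l0"] \<delta> by (auto simp: W_def intro: order_trans)
  qed
  have inner: "(\<Sum>i. hausdorff_gauge s (W k i)) \<le> ennreal (a (k + l0))" for k
  proof -
    have "(\<Sum>i. hausdorff_gauge s (W k i)) = (\<Sum>i<card (V (k + l0)). hausdorff_gauge s (W k i))"
      by (rule suminf_finite) (auto simp: W_def hausdorff_gauge_def)
    also have "\<dots> \<le> (\<Sum>i<card (V (k + l0)). ennreal (d (k + l0) powr s))"
    proof (rule sum_mono)
      fix i assume i: "i \<in> {..<card (V (k + l0))}"
      then have "diameter (W k i) powr s \<le> d (k + l0) powr s"
        using U[OF hV, of i "k + l0"] s by (intro powr_mono2) (auto simp: W_def diameter_ge_0)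
      then show "hausdorff_gauge s (W k i) \<le> ennreal (d (k + l0) powr s)"
        using s by (auto simp: hausdorff_gauge_def intro: ennreal_leI)
    qed
    also have "\<dots> = ennreal (a (k + l0))" by (simp add: a_def ennreal_mult ennreal_of_nat_eq_real_of_nat)
    finally show ?thesis .
  qed
  have sa: "summable (\<lambda>k. a (k + l0))" using sum unfolding a_def by (rule summable_ignore_initial_segment)
  have a0: "0 \<le> a l" for l by (simp add: a_def)
  have "(\<Sum>k. \<Sum>i. hausdorff_gauge s (W k i)) \<le> (\<Sum>k. ennreal (a (k + l0)))"
    using inner by (intro suminf_le) auto
  also have "\<dots> = ennreal (\<Sum>k. a (k + l0))"
    using sa a0 by (intro suminf_ennreal_eq summable_sums) auto
  also have "\<dots> \<le> ennreal e" using l2[of l0] by (intro ennreal_leI) (auto simp: l0_def)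
  finally show "\<exists>U::nat \<Rightarrow> nat \<Rightarrow> 'a set. A \<subseteq> (\<Union>k. \<Union>i. U k i) \<and> (\<forall>k i. bounded (U k i) \<and> diameter (U k i) \<le> \<delta>) \<and>
     (\<Sum>k. \<Sum>i. hausdorff_gauge s (U k i)) \<le> ennreal e"
    using cov bd by (intro exI[of _ W]) blast
qed

section \<open>Dyadic condensation\<close>

lemma sum_dyadic_blocks:
  fixes F :: "nat \<Rightarrow> 'a::comm_monoid_add"
  shows "(\<Sum>l<N. sum F {2 ^ l..<2 ^ Suc l}) = sum F {1..<2 ^ N}"
proof (induction N)
  case (Suc N)
  have "sum F {1..<2 ^ N} + sum F {2 ^ N..<2 ^ Suc N} = sum F {1..<2 ^ Suc N}"
    by (rule sum.atLeastLessThan_concat) auto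
  then show ?case using Suc by simp
qed simp

text \<open>Cauchy condensation with a weight: the block that starts at \<open>2 ^ l\<close> has
  \<open>2 ^ l\<close> terms, which raises the exponent from \<open>n\<close> to
  \<open>n + 1\<close>.\<close>

lemma dyadic_summable:
  fixes G :: "nat \<Rightarrow> real"
  assumes anti: "\<And>q r. 1 \<le> q \<Longrightarrow> q \<le> r \<Longrightarrow> G r \<le> G q" and nn: "\<And>q. 1 \<le> q \<Longrightarrow> 0 \<le> G q"
    and sum: "(\<lambda>q. G q * real q ^ n) summable_on {1..}"
  shows "summable (\<lambda>l. G (2 ^ l) * (2 ^ l) ^ (n + 1))"
proof -
  define F where "F = (\<lambda>q. G q * real q ^ n)"
  have F0: "0 \<le> F q" if "1 \<le> q" for q using nn[OF that] by (simp add: F_def)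
  define b where "b = (\<lambda>l. sum F {2 ^ l..<2 ^ Suc l})"
  have "summable b"
  proof (rule bounded_imp_summable)
    show "0 \<le> b l" for l unfolding b_def by (intro sum_nonneg F0) (auto intro: order_trans[OF one_le_power])
    show "(\<Sum>l\<le>N. b l) \<le> infsum F {1..}" for N
    proof -
      have "(\<Sum>l\<le>N. b l) = sum F {1..<2 ^ Suc N}"
        unfolding b_def lessThan_Suc_atMost[symmetric] by (rule sum_dyadic_blocks)
      also have "\<dots> \<le> infsum F {1..}"
        using sum F0 unfolding F_def[symmetric] by (intro finite_sum_le_infsum) auto
      finally show ?thesis .
    qed
  qed
  then have "summable (\<lambda>l. 2 ^ (n + 1) * b l)" by (rule summable_mult)
  \<comment> \<open>Monotonicity bounds a block from below by the value of \<open>G\<close> at its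
    right end, so block \<open>l\<close> controls the term with index \<open>Suc l\<close>.\<close>
  moreover have "norm (G (2 ^ Suc l) * (2 ^ Suc l) ^ (n + 1)) \<le> 2 ^ (n + 1) * b l" for l
  proof -
    have "(\<Sum>q\<in>{2 ^ l..<2 ^ Suc l :: nat}. G (2 ^ Suc l) * (2 ^ l) ^ n) \<le> b l"
      unfolding b_def F_def
    proof (intro sum_mono mult_mono)
      fix q :: nat assume q: "q \<in> {2 ^ l..<2 ^ Suc l}"
      have "(1::nat) \<le> 2 ^ l" by simp
      also have "2 ^ l \<le> q" using q by simp
      finally have q1: "1 \<le> q" .
      show "G (2 ^ Suc l) \<le> G q" using q q1 by (intro anti) auto
      show "0 \<le> G q" by (rule nn[OF q1])
      have "real (2 ^ l) \<le> real q" using q by (intro of_nat_mono) auto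
      then show "(2 ^ l) ^ n \<le> real q ^ n" by (intro power_mono) auto
    qed auto
    then have "2 ^ l * (G (2 ^ Suc l) * (2 ^ l) ^ n) \<le> b l" by simp
    then have "2 ^ (n + 1) * (2 ^ l * (G (2 ^ Suc l) * (2 ^ l) ^ n)) \<le> 2 ^ (n + 1) * b l"
      by (intro mult_left_mono) auto
    also have "2 ^ (n + 1) * (2 ^ l * (G (2 ^ Suc l) * (2 ^ l) ^ n)) = G (2 ^ Suc l) * (2 ^ Suc l) ^ (n + 1)"
      by (simp add: power_mult_distrib)
    finally show ?thesis using nn[of "2 ^ Suc l"] by simp
  qed
  ultimately have "summable (\<lambda>l. G (2 ^ Suc l) * (2 ^ Suc l) ^ (n + 1))"
    by (rule summable_comparison_test'[where N = 0])
  then show ?thesis by (subst summable_Suc_iff[symmetric])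
qed

section \<open>Approximable points on a graph\<close>

text \<open>At arbitrarily large levels \<open>l\<close>, an approximable point of the graph lies in
  a ball of radius of order \<open>\<psi> (2 ^ l) / 2 ^ l\<close> around a counted rational point.
  The count splits the cost of a level into a term of the condensed convergent series and a term
  that decays geometrically since \<open>s > DIM('a) / 2\<close>.\<close>

lemma hausdorff_measure_approximable_graph:
  fixes f :: "'a::euclidean_space \<Rightarrow> real" and g :: "'a \<Rightarrow> 'a"
  assumes fr: "frame (cball x0 \<rho>) L (\<lambda>t. t) (\<lambda>t. f t - g t \<bullet> t) g" and \<rho>: "0 < \<rho>"
    and dim: "2 \<le> DIM('a)" and \<psi>: "approximation_function \<psi>" and s: "real DIM('a) / 2 < s"
    and sum: "(\<lambda>q::nat. (\<psi> q / real q) powr (s + 1) * real q ^ (DIM('a) + 1)) summable_on {1..}"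
  shows "hausdorff_measure s (simult_approximable \<psi> \<inter> (\<lambda>x. (x, f x)) ` cball x0 \<rho>) = 0"
proof -
  define D where "D = cball x0 \<rho>"
  define m where "m = DIM('a)"
  define r where "r = (\<lambda>t. f t - g t \<bullet> t)"
  have fr': "frame D L (\<lambda>t. t) r g" using fr by (simp add: D_def r_def)
  have comp: "compact D" by (simp add: D_def)
  have m2: "2 \<le> m" using dim by (simp add: m_def)
  have s2: "m / 2 < s" using s by (simp add: m_def)
  have s0: "0 < s" using s2 m2 by simp
  have \<psi>1: "0 < \<psi> q" "\<psi> q < 1 / 2" if "1 \<le> q" for q using \<psi> that by (auto simp: approximation_function_def)
  have \<psi>2: "\<psi> u \<le> \<psi> q" if "1 \<le> q" "q \<le> u" for q u using \<psi> that by (auto simp: approximation_function_def)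
  \<comment> \<open>The room above the critical exponent: boundedness of \<open>T\<close> will make
    \<open>h l powr s\<close> of order at most \<open>P l powr (- (m + \<kappa>))\<close>, and
    \<open>\<kappa>\<close> is positive because \<open>2 * s > m\<close>.\<close>
  define \<kappa> where "\<kappa> = (2 * s - m) / (s + 1)"
  have \<kappa>: "0 < \<kappa>" using s2 s0 by (simp add: \<kappa>_def)
  have \<kappa>eq: "(m + 2) * (s / (s + 1)) = m + \<kappa>" using s0 by (simp add: \<kappa>_def field_simps)
  \<comment> \<open>As \<open>1 - \<theta> \<le> \<kappa> / 2\<close>, only half of this room is
    lost to the threshold of the counting theorem.\<close>
  define \<theta> where "\<theta> = max (1 / 2) (1 - \<kappa> / 2)"
  have \<theta>: "0 < \<theta>" "\<theta> < 1" "1 - \<kappa> / 2 \<le> \<theta>" using \<kappa> by (auto simp: \<theta>_def)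
  obtain K where K: "0 < K" "\<And>Q \<delta>. 2 \<le> Q \<Longrightarrow> 2 / Q \<le> \<delta> \<Longrightarrow> \<delta> \<le> Q \<Longrightarrow> Q powr (- \<theta>) \<le> \<delta> \<Longrightarrow>
    real (card (frame_points D (\<lambda>t. t) r g Q (sqrt (\<delta> * Q)) \<delta>)) \<le> K * \<delta> * Q ^ (m + 1)"
    using card_frame_points_sharp[OF fr \<rho> dim \<theta>(1,2)] unfolding D_def m_def r_def by blast
  obtain G' where G': "\<And>t. t \<in> D \<Longrightarrow> norm (g t) \<le> G'"
    using compact_imp_bounded[OF compact_continuous_image[OF frame_continuous(2)[OF fr'] comp]] by (auto simp: bounded_iff)
  define G where "G = max G' 0"
  have G: "0 \<le> G" "\<And>t. t \<in> D \<Longrightarrow> norm (g t) \<le> G" using G' by (auto simp: G_def le_max_iff_disj)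
  \<comment> \<open>For the normal displacement: the norm collects errors from \<open>m + 1\<close>
    coordinates, and subtracting the tangential error paired with the gradient adds the factor
    \<open>1 + G\<close>.\<close>
  define K0 where "K0 = (m + 1) * (1 + G)"
  have K0: "0 < K0" using G by (simp add: K0_def add_pos_nonneg)
  define P where "P = (\<lambda>l::nat. (2::real) ^ l)"
  define Q where "Q = (\<lambda>l. 2 * P l)"
  have P1: "1 \<le> P l" for l by (simp add: P_def)
  \<comment> \<open>The first summand covers the normal displacement at level \<open>l\<close>; the
    second lifts \<open>\<delta> l\<close> above the thresholds \<open>2 / Q l\<close> and
    \<open>Q l powr (- \<theta>)\<close>.\<close>
  define \<delta> where "\<delta> = (\<lambda>l. K0 * \<psi> (2 ^ l) + 2 * Q l powr (- \<theta>))"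
  define B where "B = (\<lambda>l. sqrt (\<delta> l * Q l))"
  \<comment> \<open>Once \<open>Q l \<ge> X\<close>, both \<open>\<delta> l \<le> Q l\<close> and
    \<open>m + 1 \<le> B l\<close> hold; the latter makes room for the tangential
    displacement.\<close>
  define X where "X = max (K0 + 2) ((real (m + 1))\<^sup>2 powr (1 / (1 - \<theta>)))"
  define l1 where "l1 = nat \<lceil>X\<rceil>"
  have psi: "0 < \<psi> (2 ^ l)" "\<psi> (2 ^ l) < 1 / 2" for l using \<psi>1[of "2 ^ l"] by auto
  have Q2: "2 \<le> Q l" for l using P1[of l] by (simp add: Q_def)
  have Qt: "Q l powr (- \<theta>) \<le> 1" for l
    using powr_mono[of "- \<theta>" 0 "Q l"] \<theta> Q2[of l] by simp
  have \<delta>1: "2 / Q l \<le> \<delta> l" "Q l powr (- \<theta>) \<le> \<delta> l" for l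
  proof -
    have "Q l powr - 1 \<le> Q l powr (- \<theta>)" using Q2[of l] \<theta> by (intro powr_mono) auto
    then have "2 * (1 / Q l) \<le> 2 * Q l powr (- \<theta>)" using Q2[of l] by (simp add: powr_minus field_simps)
    moreover have "0 \<le> K0 * \<psi> (2 ^ l)" using K0 psi[of l] by simp
    ultimately show "2 / Q l \<le> \<delta> l" by (simp add: \<delta>_def)
    show "Q l powr (- \<theta>) \<le> \<delta> l" using \<open>0 \<le> K0 * \<psi> (2 ^ l)\<close> powr_ge_zero[of "Q l" "- \<theta>"] unfolding \<delta>_def by linarith
  qed
  have large: "\<delta> l \<le> Q l" "m + 1 \<le> B l" if l: "l1 \<le> l" for l
  proof -
    have "X \<le> real l" using l unfolding l1_def by linarith
    also have "real l \<le> P l" unfolding P_def using of_nat_less_two_power[of l, where 'a=real] by simp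
    also have "P l \<le> Q l" using P1[of l] by (simp add: Q_def)
    finally have XQ: "X \<le> Q l" .
    have "K0 * \<psi> (2 ^ l) \<le> K0 * 1" using K0 psi[of l] by (intro mult_left_mono) auto
    then show "\<delta> l \<le> Q l" using XQ Qt[of l] by (auto simp: \<delta>_def X_def)
    have "(real (m + 1))\<^sup>2 powr (1 / (1 - \<theta>)) \<le> Q l" using XQ by (simp add: X_def)
    then have "((real (m + 1))\<^sup>2 powr (1 / (1 - \<theta>))) powr (1 - \<theta>) \<le> Q l powr (1 - \<theta>)"
      using \<theta> by (intro powr_mono2) auto
    then have "(real (m + 1))\<^sup>2 \<le> Q l powr (1 - \<theta>)" using \<theta> by (simp add: powr_powr)
    also have "\<dots> = Q l powr (- \<theta>) * Q l" using Q2[of l] by (simp add: powr_diff powr_minus field_simps)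
    also have "\<dots> \<le> \<delta> l * Q l" using \<delta>1(2)[of l] Q2[of l] by (intro mult_right_mono) auto
    finally show "m + 1 \<le> B l" unfolding B_def by (intro real_le_rsqrt)
  qed
  \<comment> \<open>Levels below \<open>l1\<close> may stay empty, since covering is only required
    at arbitrarily large levels.\<close>
  define V where "V = (\<lambda>l. if l < l1 then {} else {v\<in>frame_points D (\<lambda>t. t) r g (Q l) (B l) (\<delta> l). P l \<le> fst v})"
  define R where "R = (\<lambda>l. (m + 1) * \<psi> (2 ^ l) / P l)"
  define U where "U = (\<lambda>l (v :: 'a triple). cball ((1 / fst v) *\<^sub>R snd v) (R l))"
  have finV: "finite (V l)" for l
    using finite_frame_points[OF fr' comp] by (simp add: V_def)
  have R0: "0 \<le> R l" for l using psi[of l] P1[of l] by (simp add: R_def)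
  have dimz: "DIM('a \<times> real) = m + 1" by (simp add: m_def)
  have PP1: "P l ^ k * P l powr (- real k) = 1" for k l
    using P1[of l] powr_realpow[of "P l" k] by (simp add: powr_minus)
  have PP2: "P l powr (- \<theta>) * P l ^ k = P l powr (real k - \<theta>)" for k l
  proof -
    have "P l ^ k = P l powr real k" using P1[of l] by (simp add: powr_realpow)
    then show ?thesis by (simp add: powr_add[symmetric])
  qed
  define h where "h = (\<lambda>l. \<psi> (2 ^ l) / P l)"
  have h: "0 < h l" for l using psi[of l] P1[of l] by (simp add: h_def)
  define T where "T = (\<lambda>l. h l powr (s + 1) * P l ^ (m + 2))"
  have sumT: "summable T"
  proof -
    have "summable (\<lambda>l. (\<lambda>q. (\<psi> q / real q) powr (s + 1)) (2 ^ l) * (2 ^ l) ^ ((m + 1) + 1))"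
    proof (rule dyadic_summable)
      fix q u :: nat assume q: "1 \<le> q" "q \<le> u"
      then have "\<psi> u / real u \<le> \<psi> q / real q" using \<psi>1(1)[of u] \<psi>2[OF q] by (intro frac_le) auto
      moreover have "0 \<le> \<psi> u / real u" using \<psi>1(1)[of u] q by simp
      ultimately show "(\<psi> u / real u) powr (s + 1) \<le> (\<psi> q / real q) powr (s + 1)"
        using s0 by (intro powr_mono2) auto
    qed (use sum in \<open>auto simp: m_def\<close>)
    then show ?thesis by (simp add: T_def h_def P_def numeral_2_eq_2)
  qed
  have T0: "0 \<le> T l" for l using P1[of l] by (simp add: T_def)
  obtain C' where C': "\<And>l. T l \<le> C'"
    using summable_imp_Bseq[OF sumT] unfolding Bseq_def by (metis abs_ge_self order_trans real_norm_def)
  define C where "C = max C' 1"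
  have C: "0 < C" "\<And>l. T l \<le> C" using C' by (auto simp: C_def le_max_iff_disj)
  define C2 where "C2 = C powr (s / (s + 1))"
  \<comment> \<open>Raising the bound \<open>T l \<le> C\<close> to the power
    \<open>s / (s + 1)\<close> turns it into a decay rate for \<open>h l powr s\<close>.\<close>
  have hs: "h l powr s * P l powr (m + 1 - \<theta>) \<le> C2 * (2 powr (- (\<kappa> / 2))) ^ l" for l
  proof -
    have "h l powr (s + 1) = T l * P l powr (- (real (m + 2)))"
      unfolding T_def mult.assoc PP1 by simp
    also have "\<dots> \<le> C * P l powr (- (real (m + 2)))" using C(2) by (intro mult_right_mono) auto
    finally have "(h l powr (s + 1)) powr (s / (s + 1)) \<le> (C * P l powr (- (real (m + 2)))) powr (s / (s + 1))"
      using s0 by (intro powr_mono2) auto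
    also have "\<dots> = C2 * P l powr (- (real (m + 2) * (s / (s + 1))))"
      using C(1) by (subst powr_mult) (simp_all only: powr_powr C2_def mult_minus_left powr_ge_zero less_imp_le)
    also have "- (real (m + 2) * (s / (s + 1))) = - (m + \<kappa>)" using \<kappa>eq by simp
    finally have "h l powr s \<le> C2 * P l powr (- (m + \<kappa>))" using s0 by (simp add: powr_powr)
    then have "h l powr s * P l powr (m + 1 - \<theta>) \<le> C2 * P l powr (- (m + \<kappa>)) * P l powr (m + 1 - \<theta>)"
      by (intro mult_right_mono) auto
    also have "\<dots> = C2 * P l powr (- (m + \<kappa>) + (m + 1 - \<theta>))"
      by (simp only: powr_add[of "P l" "- (m + \<kappa>)"] mult.assoc)
    also have "\<dots> \<le> C2 * P l powr (- (\<kappa> / 2))"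
      using \<theta>(3) P1[of l] by (intro mult_left_mono powr_mono) (auto simp: C2_def)
    also have "P l powr (- (\<kappa> / 2)) = (2 powr (- (\<kappa> / 2))) ^ l"
      unfolding P_def by (simp add: powr_realpow[symmetric] powr_powr mult.commute)
    finally show ?thesis .
  qed
  define c where "c = K * 2 ^ (m + 1) * (2 * (m + 1)) powr s"
  have c0: "0 \<le> c" using K by (simp add: c_def)
  have bound: "card (V l) * (2 * R l) powr s \<le> c * K0 * T l + c * 2 * C2 * (2 powr (- (\<kappa> / 2))) ^ l" for l
  proof -
    have Rs: "(2 * R l) powr s = (2 * (m + 1)) powr s * h l powr s"
    proof -
      have "2 * R l = (2 * (m + 1)) * h l" by (simp add: R_def h_def)
      then show ?thesis by (simp only: powr_mult)
    qed
    have "real (card (V l)) \<le> K * \<delta> l * Q l ^ (m + 1)"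
    proof (cases "l < l1")
      case True
      have "0 \<le> \<delta> l" by (rule order_trans[OF _ \<delta>1(1)]) (use Q2[of l] in simp)
      then show ?thesis using True K(1) Q2[of l] by (simp add: V_def)
    next
      case False
      have "card (V l) \<le> card (frame_points D (\<lambda>t. t) r g (Q l) (B l) (\<delta> l))"
        using finite_frame_points[OF fr' comp] by (intro card_mono) (auto simp: V_def)
      then show ?thesis
        using K(2)[OF Q2[of l] \<delta>1(1)[of l] large(1)[of l] \<delta>1(2)[of l]] False unfolding B_def by linarith
    qed
    also have "\<dots> \<le> K * (K0 * h l * P l + 2 * P l powr (- \<theta>)) * Q l ^ (m + 1)"
    proof (intro mult_right_mono mult_left_mono)
      have "Q l powr (- \<theta>) \<le> P l powr (- \<theta>)"
        using P1[of l] \<theta> by (intro powr_mono2') (auto simp: Q_def)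
      then show "\<delta> l \<le> K0 * h l * P l + 2 * P l powr (- \<theta>)" using P1[of l] by (simp add: \<delta>_def h_def)
    qed (use K Q2[of l] in auto)
    finally have "card (V l) * (2 * R l) powr s \<le> K * (K0 * h l * P l + 2 * P l powr (- \<theta>)) * Q l ^ (m + 1) * ((2 * (m + 1)) powr s * h l powr s)"
      unfolding Rs by (intro mult_right_mono) auto
    also have "Q l ^ (m + 1) = 2 ^ (m + 1) * P l ^ (m + 1)" unfolding Q_def by (rule power_mult_distrib)
    \<comment> \<open>The two summands of \<open>\<delta> l\<close> separate: one yields
      \<open>T l\<close>, the other is the term controlled by \<open>hs\<close>.\<close>
    also have "K * (K0 * h l * P l + 2 * P l powr (- \<theta>)) * (2 ^ (m + 1) * P l ^ (m + 1)) * ((2 * (m + 1)) powr s * h l powr s)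
      = c * K0 * ((h l powr s * h l) * (P l * P l ^ (m + 1))) + c * 2 * (h l powr s * (P l powr (- \<theta>) * P l ^ (m + 1)))"
      by (simp add: c_def algebra_simps)
    also have "(h l powr s * h l) * (P l * P l ^ (m + 1)) = T l"
      using h[of l] by (simp add: T_def powr_add)
    also have "P l powr (- \<theta>) * P l ^ (m + 1) = P l powr (m + 1 - \<theta>)"
      using PP2[of l "m + 1"] by simp
    also have "c * K0 * T l + c * 2 * (h l powr s * P l powr (m + 1 - \<theta>)) \<le> c * K0 * T l + c * 2 * (C2 * (2 powr (- (\<kappa> / 2))) ^ l)"
      using hs[of l] c0 by (intro add_left_mono mult_left_mono) auto
    finally show ?thesis by (simp add: mult.assoc)
  qed
  have "hausdorff_measure s (simult_approximable \<psi> \<inter> (\<lambda>x. (x, f x)) ` D) = 0"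
  proof (rule hausdorff_cantelli[where V = V and U = U and d = "\<lambda>l. 2 * R l"])
    show "0 < s" by (rule s0)
    show "finite (V l)" for l by (rule finV)
    show "0 \<le> 2 * R l" for l using R0 by simp
    show "bounded (U l v) \<and> diameter (U l v) \<le> 2 * R l" for l v
      using R0[of l] by (simp add: U_def)
    show "(\<lambda>l. 2 * R l) \<longlonglongrightarrow> 0"
    proof (rule tendsto_sandwich)
      show "\<forall>\<^sub>F l in sequentially. 0 \<le> 2 * R l" using R0 by simp
      show "\<forall>\<^sub>F l in sequentially. 2 * R l \<le> 2 * (m + 1) * (1 / 2) ^ l"
      proof (intro always_eventually allI)
        fix l
        have "2 * R l = (2 * (m + 1)) * (\<psi> (2 ^ l) / P l)" by (simp add: R_def)
        also have "\<dots> \<le> (2 * (m + 1)) * (1 / P l)"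
          using psi[of l] P1[of l] by (intro mult_left_mono divide_right_mono) auto
        finally show "2 * R l \<le> 2 * (m + 1) * (1 / 2) ^ l" by (simp add: P_def power_divide)
      qed
      show "(\<lambda>l. 2 * (m + 1) * (1 / 2) ^ l :: real) \<longlonglongrightarrow> 0"
        by (intro tendsto_mult_right_zero LIMSEQ_power_zero) auto
    qed simp
    show "summable (\<lambda>l. card (V l) * (2 * R l) powr s)"
    proof (rule summable_comparison_test')
      have "2 powr (- (\<kappa> / 2)) < 2 powr (0::real)" using \<kappa> by (intro powr_less_mono) auto
      then show "summable (\<lambda>l. c * K0 * T l + c * 2 * C2 * (2 powr (- (\<kappa> / 2))) ^ l)"
        by (intro summable_add summable_mult sumT summable_geometric) auto
      show "norm (card (V l) * (2 * R l) powr s) \<le> c * K0 * T l + c * 2 * C2 * (2 powr (- (\<kappa> / 2))) ^ l" for l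
        using bound[of l] by simp
    qed
    fix z l0 assume z: "z \<in> simult_approximable \<psi> \<inter> (\<lambda>x. (x, f x)) ` D"
    then obtain t where t: "t \<in> D" "z = (t, f t)" by blast
    define l' where "l' = max l0 l1"
    have "infinite {q::nat. q \<ge> 1 \<and> Max ((\<lambda>b. dist_int (real q * (z \<bullet> b))) ` Basis) < \<psi> q}"
      using z by (simp add: simult_approximable_def)
    then obtain q where q: "q > 2 ^ l'" "q \<ge> 1" "Max ((\<lambda>b. dist_int (real q * (z \<bullet> b))) ` Basis) < \<psi> q"
      unfolding infinite_nat_iff_unbounded by blast
    obtain l where l: "2 ^ l \<le> q" "q < 2 ^ (l + 1)" using ex_power_ivl1[of 2 q] q(2) by auto
    \<comment> \<open>The level \<open>l\<close> of \<open>q\<close> is at least \<open>l'\<close>,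
      because \<open>2 ^ l'\<close> lies below the strict upper end of the dyadic range of
      \<open>q\<close>.\<close>
    have "(2::nat) ^ l' < 2 ^ (l + 1)" using q(1) l(2) by linarith
    then have "l' < l + 1" by (rule power_less_imp_less_exp[rotated]) simp
    then have ll: "l0 \<le> l" "l1 \<le> l" by (auto simp: l'_def)
    have qP: "P l \<le> real q" "real q \<le> Q l"
    proof -
      have "real (2 ^ l) \<le> real q" using l(1) by (rule of_nat_mono)
      then show "P l \<le> real q" by (simp add: P_def)
      have "real q \<le> real (2 ^ (l + 1))" using l(2) by (intro of_nat_mono) simp
      then show "real q \<le> Q l" by (simp add: P_def Q_def)
    qed
    \<comment> \<open>The distance to the closed set of integers is attained, and
      \<open>\<psi>\<close> is non-increasing, so \<open>\<psi> q\<close> may be replaced by its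
      value at the start of the dyadic range.\<close>
    have "\<exists>k\<in>\<int>. \<bar>real q * (z \<bullet> b) - k\<bar> \<le> \<psi> (2 ^ l)" if b: "b \<in> Basis" for b
    proof -
      obtain k where k: "k \<in> \<int>" "infdist (real q * (z \<bullet> b)) \<int> = dist (real q * (z \<bullet> b)) k"
        using infdist_attains_inf[of "\<int> :: real set" "real q * (z \<bullet> b)"] by (metis Ints_0 closed_Ints empty_iff)
      have "dist_int (real q * (z \<bullet> b)) < \<psi> q" using q(3) b by (subst (asm) Max_less_iff) auto
      also have "\<psi> q \<le> \<psi> (2 ^ l)" using l(1) by (intro \<psi>2) auto
      finally show ?thesis using k by (intro bexI[of _ k]) (auto simp: dist_int_def dist_real_def)
    qed
    then obtain k where k: "\<And>b. b \<in> Basis \<Longrightarrow> k b \<in> \<int>" "\<And>b. b \<in> Basis \<Longrightarrow> \<bar>real q * (z \<bullet> b) - k b\<bar> \<le> \<psi> (2 ^ l)"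
      by metis
    define w where "w = (\<Sum>b\<in>Basis. k b *\<^sub>R b)"
    have wb: "w \<bullet> b = k b" if "b \<in> Basis" for b using that by (simp add: w_def)
    have wi: "w \<in> int_points" using k(1) wb by (auto simp: int_points_def)
    define E where "E = (m + 1) * \<psi> (2 ^ l)"
    have E: "norm (w - real q *\<^sub>R z) \<le> E"
    proof -
      have "norm (w - real q *\<^sub>R z) \<le> (\<Sum>b\<in>Basis. \<bar>(w - real q *\<^sub>R z) \<bullet> b\<bar>)" by (rule norm_le_l1)
      also have "\<dots> \<le> (\<Sum>b\<in>(Basis :: ('a \<times> real) set). \<psi> (2 ^ l))"
        using k(2) wb by (intro sum_mono) (auto simp: inner_diff_left abs_minus_commute)
      also have "\<dots> = E" using dimz by (simp add: E_def)
      finally show ?thesis .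
    qed
    obtain w1 w2 where w: "w = (w1, w2)" by (cases w)
    have E1: "norm (w1 - real q *\<^sub>R t) \<le> E" "\<bar>w2 - real q * f t\<bar> \<le> E"
      using E norm_fst_le[of "w1 - real q *\<^sub>R t" "w2 - real q * f t"] norm_snd_le[of "w2 - real q * f t" "w1 - real q *\<^sub>R t"]
      by (auto simp: w t(2))
    have "(real q, w1, w2) \<in> frame_box (\<lambda>t. t) r g t (Q l) (B l) (\<delta> l)"
    proof -
      have "E \<le> real (m + 1) * 1" unfolding E_def using psi[of l] by (intro mult_left_mono) auto
      then have "norm (w1 - real q *\<^sub>R t) \<le> B l" using E1(1) large(2)[OF ll(2)] by simp
      moreover have "\<bar>w2 - real q * r t - w1 \<bullet> g t\<bar> \<le> \<delta> l"
      proof -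
        have "w2 - real q * r t - w1 \<bullet> g t = (w2 - real q * f t) - (w1 - real q *\<^sub>R t) \<bullet> g t"
          by (simp add: r_def algebra_simps inner_commute)
        moreover have "\<bar>(w1 - real q *\<^sub>R t) \<bullet> g t\<bar> \<le> E * G"
          using Cauchy_Schwarz_ineq2[of "w1 - real q *\<^sub>R t" "g t"] mult_mono[OF E1(1) G(2)[OF t(1)]] norm_ge_zero[of "w1 - real q *\<^sub>R t"] E1(1)
          by auto
        ultimately have "\<bar>w2 - real q * r t - w1 \<bullet> g t\<bar> \<le> E + E * G" using E1(2) by linarith
        also have "\<dots> = K0 * \<psi> (2 ^ l)" by (simp add: E_def K0_def algebra_simps)
        also have "\<dots> \<le> \<delta> l" by (simp add: \<delta>_def)
        finally show ?thesis .
      qed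
      ultimately show ?thesis using qP by (simp add: frame_box_def frame_bet_def frame_gam_def)
    qed
    moreover have "(real q, w) \<in> int_points" using wi by (simp add: int_points_prod int_points_real)
    ultimately have "(real q, w) \<in> V l"
      using ll(2) qP(1) t(1) by (auto simp: V_def frame_points_def w)
    moreover have "z \<in> U l (real q, w)"
    proof -
      have q0: "0 < real q" using q(2) by simp
      have "(1 / real q) *\<^sub>R w - z = (1 / real q) *\<^sub>R (w - real q *\<^sub>R z)" using q0 by (simp add: scaleR_diff_right)
      then have "dist ((1 / real q) *\<^sub>R w) z = norm (w - real q *\<^sub>R z) / real q" using q0 by (simp add: dist_norm)
      also have "\<dots> \<le> E / P l" using order_trans[OF norm_ge_zero E] E qP(1) P1[of l] by (intro frac_le) auto
      also have "\<dots> = R l" by (simp add: E_def R_def)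
      finally show ?thesis by (simp add: U_def)
    qed
    ultimately show "\<exists>l\<ge>l0. \<exists>v\<in>V l. z \<in> U l v" using ll(1) by blast
  qed
  then show ?thesis by (simp add: D_def)
qed

theorem theorem2p7:
  fixes n :: nat and d \<epsilon> s :: real and \<psi> :: "nat \<Rightarrow> real"
    and M :: "((real ^ 'm::finite) \<times> real) set"
  assumes "n \<ge> 3" and "CARD('m) = n - 1"
    and "d > 2 * (real n - 1)" and "\<epsilon> > 0"
    and "approximation_function \<psi>"
    and "s > (real n - 1) / 2"
    and "M \<in> graph_hypersurfaces (homogeneous_nondeg d)"
    and "(\<lambda>q::nat. (\<psi> q / real q) powr (s + 1) * real q ^ n) summable_on {1..}"
    and "(\<lambda>q::nat. (\<psi> q / real q) powr (s + (real n - 1) / d + \<epsilon>) * real q ^ (n - 1)) summable_on {1..}"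
  shows "hausdorff_measure s (simult_approximable \<psi> \<inter> M) = 0"
proof -
  obtain f :: "real ^ 'm \<Rightarrow> real" where f: "f \<in> homogeneous_nondeg d" and M: "M = {(x, f x) | x. norm x < 1}"
    using assms(7) by (auto simp: graph_hypersurfaces_def)
  have dim: "DIM(real ^ 'm) = n - 1" using assms(2) by simp
  have n: "n - 1 + 1 = n" "real (n - 1) = real n - 1" using assms(1) by auto
  define S where "S = simult_approximable \<psi> \<inter> range (\<lambda>x. (x, f x))"
  \<comment> \<open>The good balls cover everything except the origin, and the Lindelof property
    reduces them to countably many.\<close>
  define \<F> where "\<F> = {ball x0 \<rho> | x0 \<rho>. hausdorff_measure s (simult_approximable \<psi> \<inter> (\<lambda>x. (x, f x)) ` cball x0 \<rho>) = 0}"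
  have "open B" if "B \<in> \<F>" for B using that by (auto simp: \<F>_def)
  then obtain \<C> where \<C>: "\<C> \<subseteq> \<F>" "countable \<C>" "\<Union>\<C> = \<Union>\<F>" using Lindelof by metis
  have cov: "x \<in> \<Union>\<F>" if x: "x \<noteq> 0" for x
  proof -
    have "Ck_on 2 (UNIV - {0}) f" "det (hessian f x) \<noteq> 0"
      using f x by (auto simp: homogeneous_nondeg_def smooth_on_def)
    then obtain \<rho> L where \<rho>: "0 < \<rho>" "frame (cball x \<rho>) L (\<lambda>t. t) (\<lambda>t. f t - gradient f t \<bullet> t) (gradient f)"
      using frame_graph[of "UNIV - {0}" x f] x by auto
    have "hausdorff_measure s (simult_approximable \<psi> \<inter> (\<lambda>x. (x, f x)) ` cball x \<rho>) = 0"
      by (rule hausdorff_measure_approximable_graph[OF \<rho>(2,1)]) (use assms dim n in auto)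
    then have "ball x \<rho> \<in> \<F>" by (auto simp: \<F>_def)
    then show ?thesis using \<rho>(1) by (meson UnionI centre_in_ball)
  qed
  \<comment> \<open>Inserting the empty set makes the enumerated family nonempty.\<close>
  define b where "b = from_nat_into (insert {} \<C>)"
  \<comment> \<open>Index 0 is reserved for the point over the origin, where smoothness is not
    assumed; a single point is null because \<open>s > 0\<close>.\<close>
  define A where "A = (\<lambda>k. case k of 0 \<Rightarrow> {(0, f 0)} | Suc k \<Rightarrow> simult_approximable \<psi> \<inter> (\<lambda>x. (x, f x)) ` b k)"
  have "hausdorff_measure s (A k) = 0" for k
  proof (cases k)
    case 0
    have "0 \<le> (real n - 1) / 2" using assms(1) by simp
    then have "0 < s" using assms(6) by linarith
    then show ?thesis using 0 by (simp add: A_def hausdorff_measure_singleton)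
  next
    case (Suc j)
    have "b j \<in> insert {} \<C>" unfolding b_def by (rule from_nat_into) simp
    then consider "b j = {}" | x0 \<rho> where "b j = ball x0 \<rho>" "hausdorff_measure s (simult_approximable \<psi> \<inter> (\<lambda>x. (x, f x)) ` cball x0 \<rho>) = 0"
      using \<C>(1) unfolding \<F>_def by blast
    then show ?thesis
    proof cases
      case 1
      have "hausdorff_measure s ({} :: ((real ^ 'm) \<times> real) set) = 0"
        by (rule hausdorff_measure_eq_0I, rule exI[of _ "\<lambda>_ _. {}"]) (auto simp: hausdorff_gauge_def)
      then show ?thesis using 1 Suc by (simp add: A_def)
    next
      case 2
      show ?thesis
        by (rule hausdorff_measure_mono_0[OF 2(2)]) (use 2(1) Suc in \<open>auto simp: A_def\<close>)
    qed
  qed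
  then have "hausdorff_measure s (\<Union>k. A k) = 0" by (rule hausdorff_measure_UN_eq_0)
  moreover have "simult_approximable \<psi> \<inter> M \<subseteq> (\<Union>k. A k)"
  proof
    fix z assume z: "z \<in> simult_approximable \<psi> \<inter> M"
    then obtain x where x: "z = (x, f x)" using M by blast
    show "z \<in> (\<Union>k. A k)"
    proof (cases "x = 0")
      case True
      then have "z \<in> A 0" using x by (simp add: A_def)
      then show ?thesis by blast
    next
      case False
      then obtain B where B: "B \<in> \<C>" "x \<in> B" using cov[OF False] \<C>(3) by blast
      have "range b = insert {} \<C>" unfolding b_def using \<C>(2) by (intro range_from_nat_into) auto
      then obtain j where "b j = B" using B(1) by (metis imageE insertI2)
      then have "z \<in> A (Suc j)" using z x B(2) by (auto simp: A_def)
      then show ?thesis by blast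
    qed
  qed
  ultimately show ?thesis by (rule hausdorff_measure_mono_0)
qed

end
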